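(* The following hold. (a) Under the continuum hypothesis (CH), there is a hereditarily separable ENH-manifold. (b) Under Jensen's axiom $\diamondsuit$, there is an ENH-manifold which is not hereditarily separable but does not contain any uncountable closed discrete subspace. (c) Under $\mathrm{MA}(\omega_1)$, there are no hereditarily separable ENH-manifolds.
   Context: Each part is a ZFC implication from the named axiom; $\mathrm{MA}(\omega_1)$ is Martin's axiom for posets of cardinality $\le\omega_1$. A manifold (or $n$-manifold) is a connected (in particular nonempty) topological space each of whose points has a neighborhood homeomorphic to $\mathbb{R}^n$ for some fixed integer $n$; it is NOT assumed to be Hausdorff, second countable or metrizable. Two points of a space $X$ can be separated if they have disjoint open neighborhoods. For $x\in X$, $NH(x)$ is the set of points $y\in X$, $y\neq x$, which cannot be separated from $x$. A space is everywhere non-Hausdorff if $NH(x)\neq\varnothing$ for every $x$; an ENH-manifold is an everywhere non-Hausdorff manifold. *)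

theory Defs
  imports "HOL-Analysis.Analysis"
begin

unbundle cardinal_syntax

section \<open>The set-theoretic axioms\<close>

text \<open>The ordinal \<open>\<omega>\<^sub>1\<close> is represented by a well-order of its order type, whose field is a set of
  cardinality \<open>\<aleph>\<^sub>1\<close>; for an ordinal \<open>\<alpha>\<close> in the field, the set of smaller ordinals is
  \<open>underS omega1 \<alpha>\<close>.\<close>

definition omega1 :: "nat set rel"
  where "omega1 = cardSuc natLeq"

definition continuum_hypothesis :: bool
  where "continuum_hypothesis \<longleftrightarrow> |UNIV :: real set| =o omega1"

text \<open>In \<open>closed_unbounded\<close>, the second condition only concerns limit ordinals \<open>\<alpha>\<close>: it excludes
  \<open>0\<close> explicitly and successors because \<open>\<beta> \<noteq> \<gamma>\<close> is required.\<close>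

definition closed_unbounded :: "'a rel \<Rightarrow> 'a set \<Rightarrow> bool"
  where "closed_unbounded r C \<longleftrightarrow>
    C \<subseteq> Field r \<and> cofinal C r \<and>
    (\<forall>\<alpha>\<in>Field r. underS r \<alpha> \<noteq> {} \<and>
       (\<forall>\<beta>\<in>underS r \<alpha>. \<exists>\<gamma>\<in>C \<inter> underS r \<alpha>. \<beta> \<noteq> \<gamma> \<and> (\<beta>, \<gamma>) \<in> r) \<longrightarrow> \<alpha> \<in> C)"

definition stationary :: "'a rel \<Rightarrow> 'a set \<Rightarrow> bool"
  where "stationary r S \<longleftrightarrow> S \<subseteq> Field r \<and> (\<forall>C. closed_unbounded r C \<longrightarrow> S \<inter> C \<noteq> {})"

definition jensen_diamond :: bool
  where "jensen_diamond \<longleftrightarrow>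
    (\<exists>A :: nat set \<Rightarrow> nat set set.
       (\<forall>\<alpha>\<in>Field omega1. A \<alpha> \<subseteq> underS omega1 \<alpha>) \<and>
       (\<forall>S\<subseteq>Field omega1. stationary omega1 {\<alpha>\<in>Field omega1. S \<inter> underS omega1 \<alpha> = A \<alpha>}))"

text \<open>A pair \<open>(p, q) \<in> r\<close> means \<open>p \<le> q\<close>, that is, \<open>p\<close> is the stronger condition.\<close>

definition compatible_in :: "'p set \<Rightarrow> 'p rel \<Rightarrow> 'p \<Rightarrow> 'p \<Rightarrow> bool"
  where "compatible_in P r p q \<longleftrightarrow> (\<exists>s\<in>P. (s, p) \<in> r \<and> (s, q) \<in> r)"

definition ccc_poset :: "'p set \<Rightarrow> 'p rel \<Rightarrow> bool"
  where "ccc_poset P r \<longleftrightarrow>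
    P \<noteq> {} \<and> partial_order_on P r \<and>
    (\<forall>A\<subseteq>P. (\<forall>p\<in>A. \<forall>q\<in>A. p \<noteq> q \<longrightarrow> \<not> compatible_in P r p q) \<longrightarrow> countable A)"

definition dense_in_poset :: "'p set \<Rightarrow> 'p rel \<Rightarrow> 'p set \<Rightarrow> bool"
  where "dense_in_poset P r D \<longleftrightarrow> D \<subseteq> P \<and> (\<forall>p\<in>P. \<exists>d\<in>D. (d, p) \<in> r)"

definition filter_in_poset :: "'p set \<Rightarrow> 'p rel \<Rightarrow> 'p set \<Rightarrow> bool"
  where "filter_in_poset P r G \<longleftrightarrow>
    G \<subseteq> P \<and> G \<noteq> {} \<and>
    (\<forall>p\<in>G. \<forall>q\<in>P. (p, q) \<in> r \<longrightarrow> q \<in> G) \<and>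
    (\<forall>p\<in>G. \<forall>q\<in>G. \<exists>s\<in>G. (s, p) \<in> r \<and> (s, q) \<in> r)"

text \<open>Every poset of cardinality at most \<open>\<aleph>\<^sub>1\<close> has an isomorphic copy on a set of elements of type
  \<open>nat set\<close>, so fixing this type loses no poset.\<close>

definition martins_axiom_omega1 :: bool
  where "martins_axiom_omega1 \<longleftrightarrow>
    (\<forall>(P :: nat set set) r \<D>.
       ccc_poset P r \<and> |P| \<le>o omega1 \<and>
       |\<D>| \<le>o omega1 \<and> (\<forall>D\<in>\<D>. dense_in_poset P r D) \<longrightarrow>
       (\<exists>G. filter_in_poset P r G \<and> (\<forall>D\<in>\<D>. G \<inter> D \<noteq> {})))"


section \<open>Everywhere non-Hausdorff manifolds\<close>

text \<open>HOL cannot quantify existentially over types, so the existence of a space is to be stated over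
  a fixed carrier type. The type \<open>real set\<close>, of cardinality \<open>2\<^sup>\<kappa>\<close> with \<open>\<kappa>\<close> the continuum, is large enough for this to be no
  restriction in the cases considered: a hereditarily separable manifold has at most \<open>\<kappa>\<close>
  points, and the property of containing no uncountable closed discrete subspace is reflected to an
  elementary submodel of size \<open>2\<^bsup>\<omega>\<^sub>1\<^esup>\<close> closed under \<open>\<omega>\<^sub>1\<close>-sequences.\<close>

definition manifold :: "'a topology \<Rightarrow> bool"
  where "manifold X \<longleftrightarrow>
    connected_space X \<and> topspace X \<noteq> {} \<and>
    (\<exists>n. \<forall>x\<in>topspace X. \<exists>N U. openin X U \<and> x \<in> U \<and> U \<subseteq> N \<and> N \<subseteq> topspace X \<and>
       subtopology X N homeomorphic_space Euclidean_space n)"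

definition separated_points :: "'a topology \<Rightarrow> 'a \<Rightarrow> 'a \<Rightarrow> bool"
  where "separated_points X x y \<longleftrightarrow>
    (\<exists>U V. openin X U \<and> openin X V \<and> x \<in> U \<and> y \<in> V \<and> disjnt U V)"

definition NH :: "'a topology \<Rightarrow> 'a \<Rightarrow> 'a set"
  where "NH X x = {y \<in> topspace X. y \<noteq> x \<and> \<not> separated_points X x y}"

definition everywhere_non_Hausdorff :: "'a topology \<Rightarrow> bool"
  where "everywhere_non_Hausdorff X \<longleftrightarrow> (\<forall>x\<in>topspace X. NH X x \<noteq> {})"

definition ENH_manifold :: "'a topology \<Rightarrow> bool"
  where "ENH_manifold X \<longleftrightarrow> manifold X \<and> everywhere_non_Hausdorff X"

definition separable :: "'a topology \<Rightarrow> bool"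
  where "separable X \<longleftrightarrow> (\<exists>D. countable D \<and> D \<subseteq> topspace X \<and> X closure_of D = topspace X)"

definition hereditarily_separable :: "'a topology \<Rightarrow> bool"
  where "hereditarily_separable X \<longleftrightarrow> (\<forall>S\<subseteq>topspace X. separable (subtopology X S))"

definition has_uncountable_closed_discrete :: "'a topology \<Rightarrow> bool"
  where "has_uncountable_closed_discrete X \<longleftrightarrow>
    (\<exists>D. closedin X D \<and> uncountable D \<and> subtopology X D = discrete_topology D)"

end

theory Submission
  imports Defs "HOL-Library.Countable_Set_Type"
begin

text \<open>
  \<^emph>\<open>Martin's axiom.\<close> Let \<open>V\<close> be an open Hausdorff second countable Baire subset of an ENH-manifold,
  such as a chart. Every \<open>x \<in> V\<close> has a point \<open>y x\<close> that cannot be separated from it, and \<open>y x\<close> has a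
  Hausdorff chart \<open>B x\<close>. If \<open>y x'\<close> lies in \<open>B x\<close>, then \<open>x'\<close> lies on the boundary of \<open>B x\<close>: every
  neighbourhood of \<open>x'\<close> meets \<open>B x\<close>, while \<open>x' \<in> B x\<close> would make \<open>x'\<close> and \<open>y x'\<close> separable. The trace
  \<open>N x\<close> of this boundary on \<open>V\<close> is closed and nowhere dense. So it suffices to find an uncountable
  set of points \<open>x\<close> that is free for the set mapping \<open>N\<close>, that is, no point of it lies in \<open>N x\<close> for another
  one \<open>x\<close>: the corresponding points \<open>y x\<close> then form an uncountable discrete subspace. The Baire category
  theorem gives an \<open>\<omega>\<^sub>1\<close>-sequence whose members avoid the sets \<open>N\<close> of all earlier members.
  The poset of its finite free subsets has the countable chain condition because \<open>V\<close> is
  second countable (\<open>free_sets_ccc\<close>), and a sufficiently generic filter yields the free set.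

  \<^emph>\<open>The continuum hypothesis.\<close> Both examples are one-dimensional. Over every real \<open>t\<close> there are a few points
  \<open>(t, i)\<close> with labels \<open>i\<close>, and each point has a label function \<open>germ s t i\<close> on the line, whose graph is
  declared to be a chart. The label \<open>0\<close> gives a dense copy of the line. The label \<open>1\<close> changes this
  copy at one point only. The label functions of label \<open>2\<close> are built by recursion along an \<open>\<omega>\<^sub>1\<close>-ordering of
  the reals. All label functions vanish outside a countable set, which makes any two points over the same
  real inseparable as soon as one has label \<open>0\<close>. Countable sets of points are enumerated in type \<open>\<omega>\<^sub>1\<close>
  too, and the label function built at \<open>r\<close> runs
  through points arbitrarily close to \<open>r\<close> of every earlier set that accumulates at \<open>r\<close> on the line
  (\<open>ex_new_section\<close>). Hence if \<open>D\<close> is countable, then for all but countably many \<open>r\<close> in the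
  closure of its projection, \<open>(r, 2)\<close> is an accumulation point of \<open>D\<close>. This is the mechanism of the
  Kunen line.

  With the labels \<open>0\<close> and \<open>2\<close> every subspace is separable: a countable part whose projection is dense
  in the projection of the subspace is already dense up to
  countably many points, for each label. With all three labels, the points
  labelled \<open>1\<close> form an uncountable discrete subspace, but an uncountable closed set contains
  accumulation points labelled \<open>2\<close> of its own countable subsets, so it is not discrete. Since diamond implies the
  continuum hypothesis, this second space is the one required under diamond.
\<close>

section \<open>Countable initial segments of omega-one\<close>

lemma Card_order_omega1: "Card_order omega1"
  unfolding omega1_def by (rule cardSuc_Card_order[OF natLeq_Card_order])

lemma Well_order_omega1: "Well_order omega1"
  using Card_order_omega1 card_order_on_well_order_on by blast

lemma card_less_omega1_iff: "|A| <o omega1 \<longleftrightarrow> countable A"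
proof -
  have "|A| <o cardSuc natLeq \<longleftrightarrow> |A| \<le>o natLeq"
    by (rule cardSuc_ordLeq_ordLess[OF natLeq_Card_order card_of_Card_order])
  then show ?thesis
    by (simp add: omega1_def countable_card_le_natLeq)
qed

lemma countable_underS_omega1:
  assumes "a \<in> Field omega1"
  shows "countable (underS omega1 a)"
  using card_of_underS[OF Card_order_omega1 assms] card_less_omega1_iff by blast

lemma uncountable_Field_omega1: "uncountable (Field omega1)"
proof
  assume "countable (Field omega1)"
  then have "|Field omega1| <o omega1" using card_less_omega1_iff by blast
  moreover have "|Field omega1| =o omega1" by (rule card_of_Field_ordIso[OF Card_order_omega1])
  ultimately show False
    by (metis not_ordLess_ordIso)
qed

lemma uncountable_imp_not_subset_countable: "uncountable A \<Longrightarrow> countable B \<Longrightarrow> \<exists>a\<in>A. a \<notin> B"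
  by (meson countable_subset subsetI)

definition down_closure :: "nat set set \<Rightarrow> nat set set"
  where "down_closure B = B \<union> (\<Union>b\<in>B. underS omega1 b)"

lemma countable_down_closure:
  assumes "B \<subseteq> Field omega1" "countable B"
  shows "countable (down_closure B)"
  unfolding down_closure_def using assms countable_underS_omega1 by (auto intro!: countable_UN)

lemma omega1_less_or_eq_or_greater:
  assumes "a \<in> Field omega1" "b \<in> Field omega1"
  obtains "a \<in> underS omega1 b" | "a = b" | "b \<in> underS omega1 a"
proof -
  have "Total omega1" using Well_order_omega1 by (simp add: well_order_on_def linear_order_on_def)
  then show ?thesis using assms that unfolding total_on_def underS_def by blast
qed

lemma underS_omega1_if_not_in_down_closure:
  assumes "a \<in> Field omega1" "b \<in> Field omega1" "b \<in> B" "a \<notin> down_closure B"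
  shows "b \<in> underS omega1 a"
  using omega1_less_or_eq_or_greater[OF assms(1,2)] assms(3,4) by (auto simp: down_closure_def)

lemma underS_omega1_trans:
  assumes "a \<in> underS omega1 b" "b \<in> underS omega1 c"
  shows "a \<in> underS omega1 c"
proof -
  have "trans omega1" "antisym omega1"
    using Well_order_omega1
    by (auto simp: well_order_on_def linear_order_on_def partial_order_on_def preorder_on_def)
  moreover have "(a, b) \<in> omega1" "(b, c) \<in> omega1" "a \<noteq> b" using assms by (auto simp: underS_def)
  ultimately have "(a, c) \<in> omega1" "a \<noteq> c" by (metis transD, metis antisymD)
  then show ?thesis by (simp add: underS_def)
qed

lemma wf_omega1_less: "wf {(a, b). a \<in> underS omega1 b}"
proof -
  have "wf (omega1 - Id)" using Well_order_omega1 by (simp add: well_order_on_def)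
  moreover have "{(a, b). a \<in> underS omega1 b} = omega1 - Id"
    by (auto simp: underS_def)
  ultimately show ?thesis by simp
qed

section \<open>Martin's axiom for finite free sets\<close>

lemma card_le_omega1_iff_inj: "|P| \<le>o omega1 \<longleftrightarrow> (\<exists>f. inj_on f P \<and> f ` P \<subseteq> Field omega1)"
proof -
  have "|P| \<le>o omega1 \<longleftrightarrow> |P| \<le>o |Field omega1|"
    using card_of_Field_ordIso[OF Card_order_omega1]
    by (meson ordIso_symmetric ordLeq_ordIso_trans)
  then show ?thesis by (simp add: card_of_ordLeq)
qed

text \<open>Martin's axiom is stated for posets on one fixed type; a poset of cardinality at most \<open>\<aleph>\<^sub>1\<close>
  over any other type is replaced by an isomorphic copy there.\<close>

lemma MA_arbitrary_type:
  fixes P :: "'p set"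
  assumes MA: martins_axiom_omega1 and ccc: "ccc_poset P r" and "|P| \<le>o omega1"
    and cD: "|\<D>| \<le>o omega1" and dense: "\<And>D. D \<in> \<D> \<Longrightarrow> dense_in_poset P r D"
  shows "\<exists>G. filter_in_poset P r G \<and> (\<forall>D\<in>\<D>. G \<inter> D \<noteq> {})"
proof -
  obtain f :: "'p \<Rightarrow> nat set" where f: "inj_on f P" "f ` P \<subseteq> Field omega1"
    using assms(3) by (auto simp: card_le_omega1_iff_inj)
  define r' where "r' = {(f p, f q) | p q. p \<in> P \<and> q \<in> P \<and> (p, q) \<in> r}"
  have r'_iff: "(f p, f q) \<in> r' \<longleftrightarrow> (p, q) \<in> r" if "p \<in> P" "q \<in> P" for p q
    using that f(1) unfolding r'_def by (auto dest: inj_onD)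
  have compat: "compatible_in (f ` P) r' (f p) (f q) \<longleftrightarrow> compatible_in P r p q"
    if "p \<in> P" "q \<in> P" for p q
    using that by (auto simp: compatible_in_def r'_iff)
  have po: "partial_order_on P r" using ccc by (simp add: ccc_poset_def)
  have "ccc_poset (f ` P) r'"
    unfolding ccc_poset_def
  proof (intro conjI allI impI)
    show "f ` P \<noteq> {}" using ccc by (simp add: ccc_poset_def)
    show "partial_order_on (f ` P) r'"
      unfolding partial_order_on_def preorder_on_def
    proof (intro conjI)
      show "r' \<subseteq> f ` P \<times> f ` P" by (auto simp: r'_def)
      show "refl_on (f ` P) r'"
        using po by (auto simp: refl_on_def r'_iff partial_order_on_def preorder_on_def)
      show "trans r'"
      proof (rule transI)
        fix x y z assume "(x, y) \<in> r'" "(y, z) \<in> r'"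
        then obtain p q q' s where "x = f p" "y = f q" "y = f q'" "z = f s"
          "p \<in> P" "q \<in> P" "q' \<in> P" "s \<in> P" "(p, q) \<in> r" "(q', s) \<in> r"
          by (auto simp: r'_def)
        moreover have "q = q'" using calculation f(1) by (auto dest: inj_onD)
        moreover have "trans r" using po by (simp add: partial_order_on_def preorder_on_def)
        ultimately show "(x, z) \<in> r'" using r'_iff by (metis transD)
      qed
      have "antisym r" using po by (simp add: partial_order_on_def)
      then show "antisym r'"
        using f(1) unfolding r'_def by (auto intro!: antisymI dest: antisymD inj_onD)
    qed
    fix A assume A: "A \<subseteq> f ` P" "\<forall>p\<in>A. \<forall>q\<in>A. p \<noteq> q \<longrightarrow> \<not> compatible_in (f ` P) r' p q"
    define B where "B = {p \<in> P. f p \<in> A}"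
    have "A = f ` B" using A(1) by (auto simp: B_def)
    have "\<forall>p\<in>B. \<forall>q\<in>B. p \<noteq> q \<longrightarrow> \<not> compatible_in P r p q"
    proof (intro ballI impI)
      fix p q assume "p \<in> B" "q \<in> B" "p \<noteq> q"
      moreover have "f p \<noteq> f q" using calculation f(1) by (auto simp: B_def dest: inj_onD)
      ultimately show "\<not> compatible_in P r p q"
        using A(2) compat by (auto simp: B_def)
    qed
    then have "countable B" using ccc by (auto simp: ccc_poset_def B_def)
    then show "countable A" using \<open>A = f ` B\<close> by simp
  qed
  moreover have "|f ` P| \<le>o omega1"
    using f card_le_omega1_iff_inj[of "f ` P"] by (intro iffD2[OF card_le_omega1_iff_inj] exI[of _ id]) auto
  moreover have "|image f ` \<D>| \<le>o omega1"
    using card_of_image cD ordLeq_transitive by blast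
  moreover have "\<forall>D\<in>image f ` \<D>. dense_in_poset (f ` P) r' D"
  proof
    fix E assume "E \<in> image f ` \<D>"
    then obtain D where D: "D \<in> \<D>" "E = f ` D" by auto
    have "D \<subseteq> P" "\<And>p. p \<in> P \<Longrightarrow> \<exists>d\<in>D. (d, p) \<in> r"
      using dense[OF D(1)] by (auto simp: dense_in_poset_def)
    then show "dense_in_poset (f ` P) r' E"
      unfolding D(2) dense_in_poset_def by (force simp: r'_iff subset_iff)
  qed
  ultimately obtain G' where G': "filter_in_poset (f ` P) r' G'" "\<forall>D\<in>image f ` \<D>. G' \<inter> D \<noteq> {}"
    using MA unfolding martins_axiom_omega1_def by meson
  define G where "G = {p \<in> P. f p \<in> G'}"
  have sub: "G' \<subseteq> f ` P" using G'(1) by (simp add: filter_in_poset_def)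
  show ?thesis
  proof (intro exI conjI ballI)
    show "filter_in_poset P r G"
      unfolding filter_in_poset_def
    proof (intro conjI ballI impI)
      show "G \<subseteq> P" by (auto simp: G_def)
      show "G \<noteq> {}" using G'(1) sub by (auto simp: filter_in_poset_def G_def)
      show "q \<in> G" if "p \<in> G" "q \<in> P" "(p, q) \<in> r" for p q
        using that G'(1) r'_iff by (auto simp: filter_in_poset_def G_def)
      show "\<exists>s\<in>G. (s, p) \<in> r \<and> (s, q) \<in> r" if pq: "p \<in> G" "q \<in> G" for p q
      proof -
        obtain t where t: "t \<in> G'" "(t, f p) \<in> r'" "(t, f q) \<in> r'"
          using pq G'(1) unfolding filter_in_poset_def G_def mem_Collect_eq by meson
        then obtain s where "s \<in> P" "t = f s" using sub by auto
        then show ?thesis using t pq r'_iff by (auto simp: G_def)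
      qed
    qed
    fix D assume "D \<in> \<D>"
    moreover have "D \<subseteq> P" using dense[OF calculation] by (simp add: dense_in_poset_def)
    ultimately show "G \<inter> D \<noteq> {}" using G'(2) by (auto simp: G_def)
  qed
qed

lemma card_finite_subsets_omega1: "|{F. finite F \<and> F \<subseteq> Field omega1}| \<le>o omega1"
proof -
  let ?A = "Field omega1"
  have inf: "infinite ?A" using uncountable_Field_omega1 countable_finite by blast
  have step: "|{F. finite F \<and> card F = n \<and> F \<subseteq> ?A}| \<le>o |?A|" for n
  proof (induction n)
    case 0
    have "{F. finite F \<and> card F = 0 \<and> F \<subseteq> ?A} = {{}}" by auto
    then show ?case using inf
      by (metis card_of_singl_ordLeq finite.emptyI)
  next
    case (Suc n)
    let ?S = "{F. finite F \<and> card F = n \<and> F \<subseteq> ?A}"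
    have "{F. finite F \<and> card F = Suc n \<and> F \<subseteq> ?A} \<subseteq> (\<lambda>(a, F). insert a F) ` (?A \<times> ?S)"
    proof
      fix F assume "F \<in> {F. finite F \<and> card F = Suc n \<and> F \<subseteq> ?A}"
      then have F: "finite F" "card F = Suc n" "F \<subseteq> ?A" by auto
      then obtain a where a: "a \<in> F" by fastforce
      have "(a, F - {a}) \<in> ?A \<times> ?S" using F a by auto
      then show "F \<in> (\<lambda>(a, F). insert a F) ` (?A \<times> ?S)"
        by (rule rev_image_eqI) (simp add: insert_absorb a)
    qed
    then have "|{F. finite F \<and> card F = Suc n \<and> F \<subseteq> ?A}| \<le>o |?A \<times> ?S|"
      by (meson card_of_image card_of_mono1 ordLeq_transitive)
    moreover have "|?A \<times> ?S| \<le>o |?A|"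
      by (rule card_of_Times_ordLeq_infinite_Field[OF _ card_of_mono1[OF subset_refl] Suc card_of_Card_order])
        (simp only: Field_card_of inf not_False_eq_True)
    ultimately show ?case by (rule ordLeq_transitive)
  qed
  have "{F. finite F \<and> F \<subseteq> ?A} = (\<Union>n::nat. {F. finite F \<and> card F = n \<and> F \<subseteq> ?A})" by auto
  moreover have "|\<Union>n::nat. {F. finite F \<and> card F = n \<and> F \<subseteq> ?A}| \<le>o |?A|"
  proof (rule card_of_UNION_ordLeq_infinite[OF inf])
    show "|UNIV :: nat set| \<le>o |?A|" using inf infinite_iff_card_of_nat by blast
    show "\<forall>n\<in>UNIV. |{F. finite F \<and> card F = n \<and> F \<subseteq> ?A}| \<le>o |?A|"
      using step by simp
  qed
  ultimately have "|{F. finite F \<and> F \<subseteq> ?A}| \<le>o |?A|" by simp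
  then show ?thesis
    by (rule ordLeq_ordIso_trans[OF _ card_of_Field_ordIso[OF Card_order_omega1]])
qed

text \<open>A weak form of the \<open>\<Delta>\<close>-system lemma. All members may be taken of the same size, and \<open>R\<close> is a
  largest set that is contained in uncountably many of them.\<close>

lemma uncountable_finite_sets_root:
  fixes A :: "'a set set"
  assumes "uncountable A" and fin: "\<And>F. F \<in> A \<Longrightarrow> finite F"
  obtains R A' where "A' \<subseteq> A" "uncountable A'" "\<And>F. F \<in> A' \<Longrightarrow> R \<subseteq> F"
    "\<And>a. a \<notin> R \<Longrightarrow> countable {F \<in> A'. a \<in> F}"
proof -
  have "A = (\<Union>n::nat. {F \<in> A. card F = n})" by auto
  then have "\<exists>n. uncountable {F \<in> A. card F = n}"
    using countable_UN[of "UNIV :: nat set" "\<lambda>n. {F \<in> A. card F = n}"] assms(1) by auto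
  then obtain n where n: "uncountable {F \<in> A. card F = n}" ..
  define An where "An = {F \<in> A. card F = n}"
  define Q where "Q k \<longleftrightarrow> (\<exists>R. finite R \<and> card R = k \<and> uncountable {F \<in> An. R \<subseteq> F})" for k
  have "Q 0" using n by (auto simp: Q_def An_def intro!: exI[of _ "{}"])
  moreover have "k \<le> n" if "Q k" for k
  proof -
    from that obtain R where R: "card R = k" "uncountable {F \<in> An. R \<subseteq> F}" unfolding Q_def by blast
    then obtain F where "F \<in> An" "R \<subseteq> F"
      by (metis (mono_tags, lifting) countable_empty equals0I mem_Collect_eq)
    then show ?thesis using R(1) fin card_mono by (fastforce simp: An_def)
  qed
  ultimately obtain k where k: "Q k" "\<And>l. Q l \<Longrightarrow> l \<le> k"
    by (metis GreatestI_nat Greatest_le_nat)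
  then obtain R where R: "finite R" "card R = k" "uncountable {F \<in> An. R \<subseteq> F}"
    by (auto simp: Q_def)
  show thesis
  proof (rule that[of "{F \<in> An. R \<subseteq> F}" R])
    fix a assume a: "a \<notin> R"
    have "\<not> Q (Suc k)" using k(2) not_less_eq_eq by blast
    moreover have "card (insert a R) = Suc k" using a R by simp
    ultimately have "countable {F \<in> An. insert a R \<subseteq> F}"
      using R(1) unfolding Q_def by blast
    then show "countable {F \<in> {F \<in> An. R \<subseteq> F}. a \<in> F}"
      by (rule countable_subset[rotated]) auto
  qed (use R in \<open>auto simp: An_def\<close>)
qed

definition free_sets :: "(nat set \<Rightarrow> 'a) \<Rightarrow> (nat set \<Rightarrow> 'a set) \<Rightarrow> nat set set set"
  where "free_sets x N = {F. finite F \<and> F \<subseteq> Field omega1 \<and> (\<forall>a\<in>F. \<forall>b\<in>F. a \<noteq> b \<longrightarrow> x a \<notin> N b)}"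

text \<open>Given an uncountable family, pass to one with a root \<open>R\<close>. Every finite family of basic open
  sets that covers the points of \<open>F - R\<close> for some member \<open>F\<close> has such a member picked for it; only countably many
  members are picked. Choose \<open>G\<close> with \<open>G - R\<close> above all picked sets, and \<open>H\<close> with \<open>H - R\<close> above \<open>G\<close>. The points of
  \<open>H - R\<close> come after those of \<open>G\<close> and therefore avoid the closed set \<open>M\<close> of the forbidden sets of \<open>G - R\<close>. So they are
  covered by finitely many basic open sets off \<open>M\<close>, and the set \<open>F\<close> picked for these avoids \<open>M\<close> as well. As
  \<open>G - R\<close> is above \<open>F\<close>, the other half of freeness is automatic, and \<open>F \<union> G\<close> is free.\<close>

lemma free_sets_ccc:
  assumes V: "second_countable V"
    and x: "\<And>a. a \<in> Field omega1 \<Longrightarrow> x a \<in> topspace V"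
    and N: "\<And>a. a \<in> Field omega1 \<Longrightarrow> closedin V (N a)"
    and less: "\<And>a b. a \<in> Field omega1 \<Longrightarrow> b \<in> underS omega1 a \<Longrightarrow> x a \<notin> N b"
    and A: "A \<subseteq> free_sets x N" "uncountable A"
  shows "\<exists>F\<in>A. \<exists>G\<in>A. F \<noteq> G \<and> F \<union> G \<in> free_sets x N"
proof -
  have finA: "finite F" "F \<subseteq> Field omega1" if "F \<in> A" for F using A(1) that by (auto simp: free_sets_def)
  obtain R A' where A': "A' \<subseteq> A" "uncountable A'" "\<And>F. F \<in> A' \<Longrightarrow> R \<subseteq> F"
    and root: "\<And>a. a \<notin> R \<Longrightarrow> countable {F \<in> A'. a \<in> F}"
    by (rule uncountable_finite_sets_root[OF A(2) finA(1)]) (auto intro: that)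
  have above: "\<exists>F\<in>A'. F \<noteq> R \<and> (F - R) \<inter> C = {}" if "countable C" for C
  proof -
    have "countable (insert R (\<Union>a\<in>C - R. {F \<in> A'. a \<in> F}))"
      using that root by (intro countable_insert countable_UN) auto
    then obtain F where "F \<in> A'" "F \<notin> insert R (\<Union>a\<in>C - R. {F \<in> A'. a \<in> F})"
      by (rule bexE[OF uncountable_imp_not_subset_countable[OF A'(2)]])
    then show ?thesis by blast
  qed
  obtain \<B> where \<B>: "countable \<B>"
    and base: "\<And>U y. openin V U \<Longrightarrow> y \<in> U \<Longrightarrow> \<exists>W\<in>\<B>. y \<in> W \<and> W \<subseteq> U"
    using V unfolding second_countable_def by (elim exE conjE) blast
  define C where "C = {\<F>. finite \<F> \<and> \<F> \<subseteq> \<B> \<and> (\<exists>F\<in>A'. x ` (F - R) \<subseteq> \<Union>\<F>)}"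
  have "countable C"
    by (rule countable_subset[OF _ countable_Collect_finite_subset[OF \<B>(1)]]) (auto simp: C_def)
  have "\<forall>\<F>\<in>C. \<exists>F. F \<in> A' \<and> x ` (F - R) \<subseteq> \<Union>\<F>" unfolding C_def by blast
  from bchoice[OF this] obtain pick
    where pick: "\<forall>\<F>\<in>C. pick \<F> \<in> A' \<and> x ` (pick \<F> - R) \<subseteq> \<Union>\<F>" ..
  have pickA: "pick \<F> \<in> A" if "\<F> \<in> C" for \<F> using pick that A'(1) by blast
  have "countable (down_closure (\<Union>\<F>\<in>C. pick \<F>))"
    using finA pickA \<open>countable C\<close>
    by (intro countable_down_closure countable_UN) (auto intro: countable_finite)
  then obtain G where G: "G \<in> A'" "G \<noteq> R" "(G - R) \<inter> down_closure (\<Union>\<F>\<in>C. pick \<F>) = {}"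
    using above by blast
  have GA: "G \<in> A" using G(1) A'(1) by blast
  have "countable (down_closure G)"
    using finA[OF GA] by (intro countable_down_closure) (auto intro: countable_finite)
  then obtain H where H: "H \<in> A'" "(H - R) \<inter> down_closure G = {}"
    using above by blast
  have HA: "H \<in> A" using H(1) A'(1) by blast
  define M where "M = (\<Union>b\<in>G - R. N b)"
  have "closedin V M"
    unfolding M_def using finA[OF GA] N by (intro closedin_Union) auto
  have "x ` (H - R) \<subseteq> topspace V - M"
  proof
    fix y assume "y \<in> x ` (H - R)"
    then obtain a where a: "a \<in> H - R" "y = x a" by blast
    have aF: "a \<in> Field omega1" using a finA[OF HA] by blast
    have "x a \<notin> N b" if "b \<in> G" for b
    proof (rule less[OF aF])
      show "b \<in> underS omega1 a"
        using a H(2) finA[OF GA] that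
        by (intro underS_omega1_if_not_in_down_closure[OF aF _ that]) auto
    qed
    then show "y \<in> topspace V - M" using a x[OF aF] by (auto simp: M_def)
  qed
  moreover have "openin V (topspace V - M)" using \<open>closedin V M\<close> by blast
  ultimately have "\<forall>y\<in>x ` (H - R). \<exists>W\<in>\<B>. y \<in> W \<and> W \<subseteq> topspace V - M"
    using base by blast
  then obtain W where W: "\<And>y. y \<in> x ` (H - R) \<Longrightarrow> W y \<in> \<B> \<and> y \<in> W y \<and> W y \<subseteq> topspace V - M"
    by (auto simp: bchoice_iff Bex_def)
  define \<F> where "\<F> = W ` x ` (H - R)"
  have \<F>: "\<F> \<in> C" "\<Union>\<F> \<inter> M = {}"
  proof -
    have "finite \<F>" using finA[OF HA] by (simp add: \<F>_def)
    moreover have "x ` (H - R) \<subseteq> \<Union>\<F>" "\<F> \<subseteq> \<B>" using W by (auto simp: \<F>_def)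
    ultimately show "\<F> \<in> C" using H(1) by (auto simp: C_def)
    show "\<Union>\<F> \<inter> M = {}" using W by (auto simp: \<F>_def)
  qed
  define F where "F = pick \<F>"
  have F: "F \<in> A'" "x ` (F - R) \<inter> M = {}" using pick \<F> unfolding F_def by blast+
  have FA: "F \<in> A" using F(1) A'(1) by blast
  have FG: "a \<in> underS omega1 b" if "a \<in> F" "b \<in> G - R" for a b
    using that G(3) finA[OF GA] finA[OF FA] \<F>(1)
    by (intro underS_omega1_if_not_in_down_closure[where B = "\<Union>\<F>\<in>C. pick \<F>"]) (auto simp: F_def)
  have 1: "x a \<notin> N b" if "a \<in> F - R" "b \<in> G - R" for a b
    using that F(2) by (auto simp: M_def)
  have 2: "x b \<notin> N a" if "a \<in> F - R" "b \<in> G - R" for a b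
    using that finA[OF GA] by (intro less FG) auto
  have RF: "R \<subseteq> F" and RG: "R \<subseteq> G" using A'(3) F(1) G(1) by auto
  have free: "x a \<notin> N b" if "K \<in> A" "a \<in> K" "b \<in> K" "a \<noteq> b" for K a b
  proof -
    have "K \<in> free_sets x N" using that(1) A(1) by blast
    then show ?thesis using that(2-4) by (simp add: free_sets_def)
  qed
  have "x a \<notin> N b" if ab: "a \<in> F \<union> G" "b \<in> F \<union> G" "a \<noteq> b" for a b
  proof -
    consider "a \<in> F" "b \<in> F" | "a \<in> G" "b \<in> G" | "a \<in> F - R" "b \<in> G - R" | "b \<in> F - R" "a \<in> G - R"
      using ab RF RG by blast
    then show ?thesis
      using free[OF FA _ _ ab(3)] free[OF GA _ _ ab(3)] 1 2 by cases auto
  qed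
  then have "F \<union> G \<in> free_sets x N"
    using finA[OF FA] finA[OF GA] by (auto simp: free_sets_def)
  moreover have "F \<noteq> G"
  proof
    assume "F = G"
    obtain b where "b \<in> G - R" using RG G(2) by blast
    then have "b \<in> underS omega1 b" using FG \<open>F = G\<close> by blast
    then show False by (simp add: underS_def)
  qed
  ultimately show ?thesis using FA GA by blast
qed

lemma maximal_antichain:
  obtains A where "A \<subseteq> B" "\<And>p q. p \<in> A \<Longrightarrow> q \<in> A \<Longrightarrow> p \<noteq> q \<Longrightarrow> \<not> compatible_in P r p q"
    "\<And>q. q \<in> B \<Longrightarrow> q \<notin> A \<Longrightarrow> \<exists>p\<in>A. compatible_in P r p q"
proof -
  define \<A> where "\<A> = {A. A \<subseteq> B \<and> (\<forall>p\<in>A. \<forall>q\<in>A. p \<noteq> q \<longrightarrow> \<not> compatible_in P r p q)}"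
  have "\<exists>M\<in>\<A>. \<forall>X\<in>\<A>. M \<subseteq> X \<longrightarrow> X = M"
  proof (rule subset_Zorn_nonempty)
    show "\<A> \<noteq> {}" by (auto simp: \<A>_def)
    fix \<C> assume ne: "\<C> \<noteq> {}" and c: "subset.chain \<A> \<C>"
    show "\<Union>\<C> \<in> \<A>"
      unfolding \<A>_def
    proof (clarsimp, intro conjI ballI impI)
      show "\<Union>\<C> \<subseteq> B" using c by (auto simp: subset.chain_def \<A>_def)
      fix X p Y q assume h: "X \<in> \<C>" "p \<in> X" "Y \<in> \<C>" "q \<in> Y" "p \<noteq> q"
      then have "X \<subseteq> Y \<or> Y \<subseteq> X" "X \<in> \<A>" "Y \<in> \<A>" using c by (auto simp: subset.chain_def)
      then show "\<not> compatible_in P r p q" using h by (auto simp: \<A>_def)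
    qed
  qed
  then obtain A where A: "A \<in> \<A>" "\<And>X. X \<in> \<A> \<Longrightarrow> A \<subseteq> X \<Longrightarrow> X = A" by blast
  show thesis
  proof
    show "A \<subseteq> B" "\<And>p q. p \<in> A \<Longrightarrow> q \<in> A \<Longrightarrow> p \<noteq> q \<Longrightarrow> \<not> compatible_in P r p q"
      using A(1) by (auto simp: \<A>_def)
    fix q assume q: "q \<in> B" "q \<notin> A"
    have sym: "compatible_in P r a b \<longleftrightarrow> compatible_in P r b a" for a b
      by (auto simp: compatible_in_def)
    show "\<exists>p\<in>A. compatible_in P r p q"
    proof (rule ccontr)
      assume "\<not> ?thesis"
      then have "insert q A \<in> \<A>" using q A(1) sym by (auto simp: \<A>_def)
      then show False using A(2)[of "insert q A"] q by blast
    qed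
  qed
qed

text \<open>A generic filter has an uncountable union only below a condition \<open>p\<close> such that every extension of \<open>p\<close>
  can be extended by arbitrarily large indices. Such a \<open>p\<close> exists: otherwise every condition has a bounded
  extension, a maximal antichain of bounded conditions is countable, and an index above all
  its bounds leads to a bounded condition compatible with none of its members.\<close>

lemma MA_uncountable_free_set:
  assumes MA: martins_axiom_omega1
    and V: "second_countable V"
    and x: "\<And>a. a \<in> Field omega1 \<Longrightarrow> x a \<in> topspace V"
    and N: "\<And>a. a \<in> Field omega1 \<Longrightarrow> closedin V (N a)"
    and less: "\<And>a b. a \<in> Field omega1 \<Longrightarrow> b \<in> underS omega1 a \<Longrightarrow> x a \<notin> N b"
  shows "\<exists>S\<subseteq>Field omega1. uncountable S \<and> (\<forall>a\<in>S. \<forall>b\<in>S. a \<noteq> b \<longrightarrow> x a \<notin> N b)"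
proof -
  let ?F = "Field omega1"
  define P where "P = free_sets x N"
  define r where "r = {(F, G). F \<in> P \<and> G \<in> P \<and> G \<subseteq> F}"
  have PF: "F \<subseteq> ?F" "finite F" if "F \<in> P" for F using that by (auto simp: P_def free_sets_def)
  have compat: "compatible_in P r F G" if "F \<in> P" "G \<in> P" "F \<union> G \<in> P" for F G
    using that by (auto simp: compatible_in_def r_def intro!: bexI[of _ "F \<union> G"])
  have antichain: "countable A"
    if "A \<subseteq> P" "\<And>F G. F \<in> A \<Longrightarrow> G \<in> A \<Longrightarrow> F \<noteq> G \<Longrightarrow> \<not> compatible_in P r F G" for A
  proof (rule ccontr)
    assume "uncountable A"
    moreover have "A \<subseteq> free_sets x N" using that(1) by (simp add: P_def)
    ultimately have "\<exists>F\<in>A. \<exists>G\<in>A. F \<noteq> G \<and> F \<union> G \<in> P"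
      unfolding P_def by (intro free_sets_ccc[OF V x N less])
    then obtain F G where FG: "F \<in> A" "G \<in> A" "F \<noteq> G" "F \<union> G \<in> P" by blast
    then have "compatible_in P r F G" using that(1) by (intro compat) auto
    then show False using that(2) FG by blast
  qed
  have "\<exists>p\<in>P. \<forall>q\<in>P. p \<subseteq> q \<longrightarrow> (\<forall>a\<in>?F. \<exists>s\<in>P. q \<subseteq> s \<and> (\<exists>b\<in>s. a \<in> underS omega1 b))"
  proof (rule ccontr)
    assume *: "\<not> ?thesis"
    \<comment> \<open>The bounded conditions: no extension has an index above \<open>a\<close>.\<close>
    define B where "B = {q \<in> P. \<exists>a\<in>?F. \<forall>s\<in>P. q \<subseteq> s \<longrightarrow> (\<forall>b\<in>s. a \<notin> underS omega1 b)}"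
    have ext: "\<exists>q\<in>B. p \<subseteq> q" if "p \<in> P" for p
    proof -
      have "\<not> (\<forall>q\<in>P. p \<subseteq> q \<longrightarrow> (\<forall>a\<in>?F. \<exists>s\<in>P. q \<subseteq> s \<and> (\<exists>b\<in>s. a \<in> underS omega1 b)))"
        using * that by (simp only: bex_simps) blast
      then obtain q a where "q \<in> P" "p \<subseteq> q" "a \<in> ?F" "\<not> (\<exists>s\<in>P. q \<subseteq> s \<and> (\<exists>b\<in>s. a \<in> underS omega1 b))"
        by (simp only: ball_simps not_imp) blast
      then have "q \<in> B" unfolding B_def by simp blast
      then show ?thesis using \<open>p \<subseteq> q\<close> by blast
    qed
    obtain A where A: "A \<subseteq> B" "\<And>p q. p \<in> A \<Longrightarrow> q \<in> A \<Longrightarrow> p \<noteq> q \<Longrightarrow> \<not> compatible_in P r p q"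
      "\<And>q. q \<in> B \<Longrightarrow> q \<notin> A \<Longrightarrow> \<exists>p\<in>A. compatible_in P r p q"
      using maximal_antichain[of B P r] by blast
    have "countable A" by (rule antichain) (use A in \<open>auto simp: B_def\<close>)
    have "\<forall>q\<in>A. \<exists>a\<in>?F. \<forall>s\<in>P. q \<subseteq> s \<longrightarrow> (\<forall>b\<in>s. a \<notin> underS omega1 b)"
      using A(1) by (auto simp: B_def)
    then obtain bd where bd: "\<And>q. q \<in> A \<Longrightarrow> bd q \<in> ?F"
      "\<And>q s b. q \<in> A \<Longrightarrow> s \<in> P \<Longrightarrow> q \<subseteq> s \<Longrightarrow> b \<in> s \<Longrightarrow> bd q \<notin> underS omega1 b" by metis
    have "countable (down_closure (bd ` A))"
      using bd(1) \<open>countable A\<close> by (intro countable_down_closure) auto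
    then obtain c where c: "c \<in> ?F" "c \<notin> down_closure (bd ` A)"
      by (rule bexE[OF uncountable_imp_not_subset_countable[OF uncountable_Field_omega1]])
    have cP: "{c} \<in> P" using c(1) by (auto simp: P_def free_sets_def)
    from ext[OF cP] obtain q where "q \<in> B" "{c} \<subseteq> q" ..
    then have q: "q \<in> B" "q \<in> P" "c \<in> q" by (auto simp: B_def)
    have "\<exists>p\<in>A. compatible_in P r p q"
    proof (cases "q \<in> A")
      case True
      then show ?thesis using q compat[of q q] by auto
    qed (use A(3) q in auto)
    then obtain p s where "p \<in> A" "s \<in> P" "p \<subseteq> s" "q \<subseteq> s"
      by (auto simp: compatible_in_def r_def)
    moreover have "bd p \<in> underS omega1 c"
      using c bd(1) calculation(1) by (intro underS_omega1_if_not_in_down_closure) auto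
    ultimately show False using bd(2) q(3) by blast
  qed
  then obtain p where p: "p \<in> P"
    "\<forall>q\<in>P. p \<subseteq> q \<longrightarrow> (\<forall>a\<in>?F. \<exists>s\<in>P. q \<subseteq> s \<and> (\<exists>b\<in>s. a \<in> underS omega1 b))" ..
  define P' where "P' = {q \<in> P. p \<subseteq> q}"
  define r' where "r' = {(F, G). F \<in> P' \<and> G \<in> P' \<and> G \<subseteq> F}"
  define D where "D a = {q \<in> P'. \<exists>b\<in>q. a \<in> underS omega1 b}" for a
  have "ccc_poset P' r'"
    unfolding ccc_poset_def
  proof (intro conjI allI impI)
    show "P' \<noteq> {}" using p(1) by (auto simp: P'_def)
    show "partial_order_on P' r'"
      unfolding partial_order_on_def preorder_on_def
      by (auto simp: r'_def refl_on_def trans_def antisym_def)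
    fix A assume A: "A \<subseteq> P'" "\<forall>F\<in>A. \<forall>G\<in>A. F \<noteq> G \<longrightarrow> \<not> compatible_in P' r' F G"
    show "countable A"
    proof (rule antichain)
      show "A \<subseteq> P" using A(1) by (auto simp: P'_def)
      fix F G assume "F \<in> A" "G \<in> A" "F \<noteq> G"
      then have "\<not> compatible_in P' r' F G" "F \<in> P'" "G \<in> P'" using A by auto
      then show "\<not> compatible_in P r F G"
        by (auto simp: compatible_in_def r_def r'_def P'_def)
    qed
  qed
  moreover have "|P'| \<le>o omega1"
  proof -
    have "P' \<subseteq> {F. finite F \<and> F \<subseteq> ?F}" using PF by (auto simp: P'_def)
    then show ?thesis using card_of_mono1 card_finite_subsets_omega1 ordLeq_transitive by blast
  qed
  moreover have "|D ` ?F| \<le>o omega1"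
    using card_of_image[of D ?F] card_of_Field_ordIso[OF Card_order_omega1] ordLeq_ordIso_trans by blast
  moreover have dense: "dense_in_poset P' r' E" if "E \<in> D ` ?F" for E
  proof -
    obtain a where a: "a \<in> ?F" "E = D a" using \<open>E \<in> D ` ?F\<close> by blast
    have "\<exists>s\<in>D a. (s, q) \<in> r'" if q: "q \<in> P'" for q
    proof -
      have "q \<in> P" "p \<subseteq> q" using q by (auto simp: P'_def)
      from p(2)[rule_format, OF this a(1)]
      obtain s where "s \<in> P" "q \<subseteq> s" "\<exists>b\<in>s. a \<in> underS omega1 b" by blast
      then show ?thesis using q by (auto simp: D_def r'_def P'_def)
    qed
    then show ?thesis unfolding a(2) dense_in_poset_def by (auto simp: D_def)
  qed
  ultimately have "\<exists>G. filter_in_poset P' r' G \<and> (\<forall>E\<in>D ` ?F. G \<inter> E \<noteq> {})"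
    by (rule MA_arbitrary_type[OF MA])
  then obtain G where G: "filter_in_poset P' r' G" "\<forall>E\<in>D ` ?F. G \<inter> E \<noteq> {}" by (elim exE conjE)
  have GP: "G \<subseteq> P'" using G(1) by (simp add: filter_in_poset_def)
  show ?thesis
  proof (intro exI conjI ballI impI)
    show sub: "\<Union>G \<subseteq> ?F" using GP PF by (auto simp: P'_def)
    show "uncountable (\<Union>G)"
    proof
      assume "countable (\<Union>G)"
      then have "countable (down_closure (\<Union>G))" using sub by (intro countable_down_closure)
      then obtain a where a: "a \<in> ?F" "a \<notin> down_closure (\<Union>G)"
        by (rule bexE[OF uncountable_imp_not_subset_countable[OF uncountable_Field_omega1]])
      then have "G \<inter> D a \<noteq> {}" using G(2) by blast
      then show False using a(2) by (auto simp: D_def down_closure_def)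
    qed
    fix a b assume ab: "a \<in> \<Union>G" "b \<in> \<Union>G" "a \<noteq> b"
    then obtain F H where "F \<in> G" "H \<in> G" "a \<in> F" "b \<in> H" by blast
    moreover from this obtain K where "K \<in> G" "(K, F) \<in> r'" "(K, H) \<in> r'"
      using G(1) unfolding filter_in_poset_def by blast
    ultimately have "K \<in> P" "a \<in> K" "b \<in> K" using GP by (auto simp: r'_def P'_def)
    then show "x a \<notin> N b" using ab(3) by (auto simp: P_def free_sets_def)
  qed
qed

section \<open>Non-separated points in locally Euclidean spaces\<close>

text \<open>The Euclidean neighbourhoods in the definition of a manifold need not be open; the properties
  used below pass to the open sets inside them.\<close>

lemma manifold_obtains_chart:
  assumes "manifold X" "x \<in> topspace X"
  obtains U where "openin X U" "x \<in> U" "Hausdorff_space (subtopology X U)"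
    "locally_compact_space (subtopology X U)" "second_countable (subtopology X U)"
proof -
  obtain n N U where U: "openin X U" "x \<in> U" "U \<subseteq> N" "N \<subseteq> topspace X"
    and hom: "subtopology X N homeomorphic_space Euclidean_space n"
    using assms unfolding manifold_def by metis
  have 1: "Hausdorff_space (Euclidean_space n)" by (rule Hausdorff_Euclidean_space)
  have 2: "second_countable (Euclidean_space n)"
  proof -
    obtain \<B> :: "(nat \<Rightarrow> real) set set" where "countable \<B>" "topological_basis \<B>"
      using ex_countable_basis by blast
    have "\<forall>W\<in>\<B>. open W" using \<open>topological_basis \<B>\<close> topological_basis_open by blast
    moreover have "\<exists>W\<in>\<B>. y \<in> W \<and> W \<subseteq> U" if "open U" "y \<in> U" for U y
      by (rule topological_basisE[OF \<open>topological_basis \<B>\<close> that]) (rule bexI, rule conjI)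
    ultimately have "second_countable (euclidean :: (nat \<Rightarrow> real) topology)"
      using \<open>countable \<B>\<close> unfolding second_countable_def open_openin[symmetric] by blast
    then show ?thesis
      by (simp add: Euclidean_space_def euclidean_product_topology second_countable_subtopology)
  qed
  have 3: "locally_compact_space (Euclidean_space n)" by (rule locally_compact_Euclidean_space)
  have sub: "subtopology (subtopology X N) U = subtopology X U"
    using U(3) by (simp add: subtopology_subtopology inf.absorb2)
  have op: "openin (subtopology X N) U"
    unfolding openin_subtopology using U(1,3) by blast
  have H: "Hausdorff_space (subtopology X N)" using homeomorphic_Hausdorff_space[OF hom] 1 by simp
  have L: "locally_compact_space (subtopology X N)" using homeomorphic_locally_compact_space[OF hom] 3 by simp
  have S: "second_countable (subtopology X N)" using homeomorphic_space_second_countability[OF hom] 2 by simp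
  show thesis
    using that[OF U(1,2)] Hausdorff_space_subtopology[OF H, of U] second_countable_subtopology[OF S, of U]
      locally_compact_space_open_subset[of "subtopology X N" U] H L op sub by auto
qed

lemma separated_in_Hausdorff_open_subset:
  assumes "openin X U" "Hausdorff_space (subtopology X U)" "x \<in> U" "y \<in> U" "x \<noteq> y"
  shows "separated_points X x y"
proof -
  have "topspace (subtopology X U) = U" using assms(1) by (simp add: openin_subset inf.absorb2)
  then obtain A B where "openin (subtopology X U) A" "openin (subtopology X U) B" "x \<in> A" "y \<in> B" "disjnt A B"
    using assms unfolding Hausdorff_space_def by metis
  then show ?thesis using assms(1) unfolding separated_points_def by (metis openin_open_subtopology)
qed

lemma not_hereditarily_separable_if_uncountable_discrete:
  assumes YX: "Y \<subseteq> topspace X" and "uncountable Y"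
    and iso: "\<And>y. y \<in> Y \<Longrightarrow> \<exists>U. openin X U \<and> Y \<inter> U = {y}"
  shows "\<not> hereditarily_separable X"
proof -
  have "\<not> separable (subtopology X Y)"
  proof
    assume "separable (subtopology X Y)"
    then obtain D where D: "countable D" "D \<subseteq> Y" "subtopology X Y closure_of D = Y"
      unfolding separable_def using YX by (auto simp: inf.absorb2)
    have "Y \<subseteq> D"
    proof
      fix y assume y: "y \<in> Y"
      from iso[OF y] obtain U where U: "openin X U" "Y \<inter> U = {y}" by blast
      have "openin (subtopology X Y) (Y \<inter> U)" using U(1) by (auto simp: openin_subtopology)
      moreover have "y \<in> subtopology X Y closure_of D" using y D(3) by simp
      moreover have "y \<in> Y \<inter> U" using U(2) by simp
      ultimately obtain w where "w \<in> D" "w \<in> Y \<inter> U" unfolding in_closure_of by blast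
      then show "y \<in> D" using U(2) by simp
    qed
    then show False using D(1) \<open>uncountable Y\<close> countable_subset by blast
  qed
  then show ?thesis using YX by (auto simp: hereditarily_separable_def)
qed

lemma MA_ENH_manifold_not_hereditarily_separable:
  assumes MA: martins_axiom_omega1 and X: "ENH_manifold X"
  shows "\<not> hereditarily_separable X"
proof -
  have man: "manifold X" and ENH: "\<And>x. x \<in> topspace X \<Longrightarrow> NH X x \<noteq> {}"
    using X by (auto simp: ENH_manifold_def everywhere_non_Hausdorff_def)
  have "topspace X \<noteq> {}" using man unfolding manifold_def by (elim conjE)
  then obtain x0 where "x0 \<in> topspace X" by blast
  then obtain V where V: "openin X V" "x0 \<in> V" "Hausdorff_space (subtopology X V)"
    "locally_compact_space (subtopology X V)" "second_countable (subtopology X V)"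
    using manifold_obtains_chart[OF man] by metis
  have VX: "V \<subseteq> topspace X" using V(1) by (rule openin_subset)
  have topV: "topspace (subtopology X V) = V" using VX by (simp add: inf.absorb2)
  have "\<exists>y U. y \<in> NH X x \<and> openin X U \<and> y \<in> U \<and> Hausdorff_space (subtopology X U)" if "x \<in> V" for x
  proof -
    have "NH X x \<noteq> {}" using ENH that VX by blast
    then obtain y where y: "y \<in> NH X x" by blast
    then have "y \<in> topspace X" by (simp add: NH_def)
    then show ?thesis using manifold_obtains_chart[OF man] y by metis
  qed
  then obtain y B where y: "\<And>x. x \<in> V \<Longrightarrow> y x \<in> NH X x"
    and B: "\<And>x. x \<in> V \<Longrightarrow> openin X (B x)" "\<And>x. x \<in> V \<Longrightarrow> y x \<in> B x"
      "\<And>x. x \<in> V \<Longrightarrow> Hausdorff_space (subtopology X (B x))"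
    by metis
  define N where "N x = V \<inter> X closure_of (B x) - B x" for x
  have N_closed: "closedin (subtopology X V) (N x)" if "x \<in> V" for x
  proof -
    have "closedin X (X closure_of (B x) - B x)" using B(1)[OF that] by (simp add: closedin_diff)
    moreover have "N x = V \<inter> (X closure_of (B x) - B x)" by (auto simp: N_def)
    ultimately show ?thesis by (auto simp: closedin_subtopology)
  qed
  have N_nowhere_dense: "subtopology X V interior_of (N x) = {}" if "x \<in> V" for x
  proof -
    have "W = {}" if W: "openin (subtopology X V) W" "W \<subseteq> N x" for W
    proof (rule ccontr)
      assume "W \<noteq> {}"
      have "openin X W" using W(1) V(1) by (metis openin_open_subtopology)
      moreover have "W \<inter> X closure_of (B x) \<noteq> {}" using W(2) \<open>W \<noteq> {}\<close> by (auto simp: N_def)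
      ultimately have "W \<inter> B x \<noteq> {}"
        by (metis openin_Int_closure_of_eq_empty)
      then show False using W(2) by (auto simp: N_def)
    qed
    then show ?thesis
      by (metis interior_of_subset openin_interior_of)
  qed
  have y_in_B: "x' \<in> N x" if "x \<in> V" "x' \<in> V" "y x' \<in> B x" for x x'
  proof -
    have nsep: "y x' \<noteq> x'" "\<not> separated_points X x' (y x')" using y[OF that(2)] by (auto simp: NH_def)
    have "x' \<notin> B x"
      using separated_in_Hausdorff_open_subset[OF B(1,3)[OF that(1)], of x' "y x'"] nsep that(3) by metis
    moreover have "x' \<in> X closure_of (B x)"
      using nsep(2) that B(1)[OF that(1)] VX
      unfolding in_closure_of separated_points_def disjnt_iff by blast
    ultimately show ?thesis using that(2) by (simp add: N_def)
  qed
  \<comment> \<open>Countably many closed nowhere dense sets do not cover \<open>V\<close>, so the sequence can always be continued.\<close>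
  have "\<exists>x. \<forall>a. a \<in> Field omega1 \<longrightarrow> x a \<in> V \<and> (\<forall>b\<in>underS omega1 a. x a \<notin> N (x b))"
  proof (rule dependent_wf_choice[OF wf_omega1_less,
      where P = "\<lambda>x a z. a \<in> Field omega1 \<longrightarrow> z \<in> V \<and> (\<forall>b\<in>underS omega1 a. z \<notin> N (x b))"], goal_cases)
    case (1 f g x r)
    then show ?case by auto
  next
    case (2 a x)
    show ?case
    proof (cases "a \<in> Field omega1")
      case True
      have xb: "x b \<in> V" if "b \<in> underS omega1 a" for b
        using 2[of b] that by (auto simp: underS_def Field_def)
      have "subtopology X V interior_of (\<Union>((\<lambda>b. N (x b)) ` underS omega1 a)) = {}"
      proof (rule Baire_category_alt)
        show "completely_metrizable_space (subtopology X V) \<or>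
            locally_compact_space (subtopology X V) \<and> regular_space (subtopology X V)"
          using V(3,4) locally_compact_Hausdorff_imp_regular_space by blast
        show "countable ((\<lambda>b. N (x b)) ` underS omega1 a)"
          using countable_underS_omega1[OF True] by simp
      qed (use N_closed N_nowhere_dense xb in auto)
      then have "\<Union>((\<lambda>b. N (x b)) ` underS omega1 a) \<noteq> V"
        using V(2) topV interior_of_topspace[of "subtopology X V"] by force
      moreover have "\<Union>((\<lambda>b. N (x b)) ` underS omega1 a) \<subseteq> V" by (auto simp: N_def)
      ultimately show ?thesis by blast
    qed auto
  qed
  then obtain x where x: "\<And>a. a \<in> Field omega1 \<Longrightarrow> x a \<in> V"
    "\<And>a b. a \<in> Field omega1 \<Longrightarrow> b \<in> underS omega1 a \<Longrightarrow> x a \<notin> N (x b)" by blast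
  have "\<exists>S\<subseteq>Field omega1. uncountable S \<and> (\<forall>a\<in>S. \<forall>b\<in>S. a \<noteq> b \<longrightarrow> x a \<notin> N (x b))"
  proof (rule MA_uncountable_free_set[OF MA V(5)])
    show "x a \<in> topspace (subtopology X V)" if "a \<in> Field omega1" for a
      using x(1)[OF that] topV by simp
    show "closedin (subtopology X V) (N (x a))" if "a \<in> Field omega1" for a
      using N_closed x(1)[OF that] .
  qed (rule x(2))
  then obtain S where S: "S \<subseteq> Field omega1" "uncountable S"
    and free: "\<forall>a\<in>S. \<forall>b\<in>S. a \<noteq> b \<longrightarrow> x a \<notin> N (x b)"
    by (elim exE conjE)
  have xS: "x a \<in> V" if "a \<in> S" for a using S(1) x(1) that by blast
  have isolated: "a = b" if "a \<in> S" "b \<in> S" "y (x a) \<in> B (x b)" for a b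
    using y_in_B[OF xS[OF that(2)] xS[OF that(1)] that(3)] free that(1,2) by blast
  define Y where "Y = (\<lambda>a. y (x a)) ` S"
  have YX: "Y \<subseteq> topspace X" using y xS by (auto simp: Y_def NH_def)
  have "inj_on (\<lambda>a. y (x a)) S"
    by (rule inj_onI) (metis isolated B(2) xS)
  then have "uncountable Y" using S(2) by (simp add: Y_def countable_image_inj_eq)
  show ?thesis
  proof (rule not_hereditarily_separable_if_uncountable_discrete[OF YX \<open>uncountable Y\<close>])
    fix z assume z: "z \<in> Y"
    then obtain a where a: "a \<in> S" "z = y (x a)" by (auto simp: Y_def)
    have "Y \<inter> B (x a) = {z}"
      using isolated a B(2) xS by (auto simp: Y_def)
    then show "\<exists>U. openin X U \<and> Y \<inter> U = {z}" using B(1)[OF xS[OF a(1)]] by blast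
  qed
qed

section \<open>Diamond implies the continuum hypothesis\<close>

lemma final_segment_closed_unbounded:
  assumes d: "d \<in> Field omega1"
  shows "closed_unbounded omega1 {a \<in> Field omega1. d \<in> underS omega1 a}"
  unfolding closed_unbounded_def
proof (intro conjI ballI impI)
  show "cofinal {a \<in> Field omega1. d \<in> underS omega1 a} omega1"
    unfolding cofinal_def
  proof
    fix a assume a: "a \<in> Field omega1"
    have "countable (down_closure {a, d})"
      using a d by (intro countable_down_closure) auto
    from uncountable_imp_not_subset_countable[OF uncountable_Field_omega1 this]
    obtain b where b: "b \<in> Field omega1" "b \<notin> down_closure {a, d}" ..
    have "a \<in> underS omega1 b" "d \<in> underS omega1 b"
      by (rule underS_omega1_if_not_in_down_closure[OF b(1) _ _ b(2)]; use a d in simp)+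
    then show "\<exists>b\<in>{a \<in> Field omega1. d \<in> underS omega1 a}. a \<noteq> b \<and> (a, b) \<in> omega1"
      using b(1) by (auto simp: underS_def)
  qed
next
  fix a assume a: "a \<in> Field omega1"
  assume *: "underS omega1 a \<noteq> {} \<and> (\<forall>b\<in>underS omega1 a.
    \<exists>c\<in>{a \<in> Field omega1. d \<in> underS omega1 a} \<inter> underS omega1 a. b \<noteq> c \<and> (b, c) \<in> omega1)"
  then obtain c where c: "d \<in> underS omega1 c" "c \<in> underS omega1 a" by blast
  from underS_omega1_trans[OF c] show "a \<in> {a \<in> Field omega1. d \<in> underS omega1 a}" using a by simp
qed auto

lemma omega1_le_continuum: "omega1 \<le>o |UNIV :: real set|"
proof -
  have "natLeq <o |UNIV :: real set|"
  proof -
    have "\<not> |UNIV :: real set| \<le>o natLeq"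
      using uncountable_UNIV_real by (simp add: countable_card_le_natLeq)
    then show ?thesis
      by (rule iffD1[OF not_ordLeq_iff_ordLess[OF natLeq_Well_order card_of_Well_order]])
  qed
  then show ?thesis
    unfolding omega1_def by (rule cardSuc_least[OF natLeq_Card_order card_of_Card_order])
qed

text \<open>Identify \<open>\<nat>\<close> with a countable subset of \<open>\<omega>\<^sub>1\<close> below some \<open>d\<close>. A set of natural numbers, viewed as a subset of
  \<open>\<omega>\<^sub>1\<close>, is guessed correctly at some ordinal above \<open>d\<close>, and the guess there contains all of it. So
  the \<open>\<aleph>\<^sub>1\<close> guesses exhaust the sets of natural numbers.\<close>

lemma jensen_diamond_imp_continuum_hypothesis:
  assumes jensen_diamond
  shows continuum_hypothesis
proof -
  let ?F = "Field omega1"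
  from assms obtain A :: "nat set \<Rightarrow> nat set set" where
    A: "\<forall>S\<subseteq>?F. stationary omega1 {a \<in> ?F. S \<inter> underS omega1 a = A a}"
    unfolding jensen_diamond_def by blast
  have "infinite ?F" using uncountable_Field_omega1 countable_finite by blast
  from infinite_countable_subset[OF this] obtain f :: "nat \<Rightarrow> nat set"
    where f: "inj f" "range f \<subseteq> ?F" by (elim exE conjE)
  have "countable (down_closure (range f))"
    using f(2) by (intro countable_down_closure) auto
  from uncountable_imp_not_subset_countable[OF uncountable_Field_omega1 this]
  obtain d where d: "d \<in> ?F" "d \<notin> down_closure (range f)" ..
  have fd: "f n \<in> underS omega1 d" for n
    using f(2) by (intro underS_omega1_if_not_in_down_closure[OF d(1) _ _ d(2)]) auto
  have guess: "\<exists>a\<in>?F. f -` A a = S" for S :: "nat set"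
  proof -
    have "f ` S \<subseteq> ?F" using f(2) by blast
    then have "stationary omega1 {a \<in> ?F. f ` S \<inter> underS omega1 a = A a}" using A by blast
    then have "{a \<in> ?F. f ` S \<inter> underS omega1 a = A a} \<inter> {a \<in> ?F. d \<in> underS omega1 a} \<noteq> {}"
      using final_segment_closed_unbounded[OF d(1)] unfolding stationary_def by simp
    then obtain a where a: "a \<in> ?F" "f ` S \<inter> underS omega1 a = A a" "d \<in> underS omega1 a"
      by auto
    have "f ` S \<subseteq> underS omega1 a"
      using underS_omega1_trans[OF fd a(3)] by blast
    then have "f ` S = A a" using a(2) by blast
    then have "f -` A a = S" using f(1) by (metis inj_vimage_image_eq)
    then show ?thesis using a(1) by blast
  qed
  have "(UNIV :: nat set set) \<subseteq> (\<lambda>a. f -` A a) ` ?F"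
  proof
    fix S :: "nat set"
    from guess[of S] obtain a where "a \<in> ?F" "f -` A a = S" ..
    then show "S \<in> (\<lambda>a. f -` A a) ` ?F" by (intro image_eqI[of _ _ a]) simp_all
  qed
  then have "|UNIV :: nat set set| \<le>o |?F|"
    by (rule surj_imp_ordLeq)
  moreover have "|UNIV :: real set| =o |UNIV :: nat set set|"
    using nat_sets_eqpoll_reals by (simp add: eqpoll_iff_card_of_ordIso ordIso_symmetric)
  ultimately have "|UNIV :: real set| \<le>o omega1"
    by (intro ordLeq_ordIso_trans[OF ordIso_ordLeq_trans card_of_Field_ordIso[OF Card_order_omega1]])
  then show ?thesis
    unfolding continuum_hypothesis_def ordIso_iff_ordLeq using omega1_le_continuum by blast
qed

section \<open>Enumerations of the reals under the continuum hypothesis\<close>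

lemma CH_imp_ex_order:
  assumes continuum_hypothesis
  shows "\<exists>L :: (real \<times> real) set. wf L \<and> trans L \<and> total L \<and> (\<forall>r. countable {t. (t, r) \<in> L})"
proof -
  have "|UNIV :: real set| =o |Field omega1|"
    using assms unfolding continuum_hypothesis_def
    by (rule ordIso_transitive[OF _ ordIso_symmetric[OF card_of_Field_ordIso[OF Card_order_omega1]]])
  then obtain f where f: "bij_betw f (UNIV :: real set) (Field omega1)"
    using card_of_ordIso by blast
  then have inj: "inj f" and fF: "f t \<in> Field omega1" for t by (auto simp: bij_betw_def)
  define L where "L = {(t, r). f t \<in> underS omega1 (f r)}"
  show ?thesis
  proof (intro exI conjI allI)
    have "L = inv_image {(a, b). a \<in> underS omega1 b} f" by (auto simp: L_def inv_image_def)
    then show "wf L" using wf_inv_image[OF wf_omega1_less] by simp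
    show "trans L"
      unfolding L_def by (rule transI) (auto intro: underS_omega1_trans)
    show "total L"
      unfolding total_on_def
    proof (intro ballI impI)
      fix t r :: real assume "t \<noteq> r"
      then have "f t \<noteq> f r" using inj by (auto dest: injD)
      then show "(t, r) \<in> L \<or> (r, t) \<in> L"
        using omega1_less_or_eq_or_greater[OF fF fF, of t r] by (auto simp: L_def)
    qed
    fix r
    have "countable (f ` (f -` underS omega1 (f r)))"
      by (rule countable_subset[OF _ countable_underS_omega1[OF fF]]) auto
    then have "countable (f -` underS omega1 (f r))"
      by (rule countable_image_inj_on) (use inj in \<open>auto intro: inj_on_subset\<close>)
    then show "countable {t. (t, r) \<in> L}" by (simp add: L_def vimage_def)
  qed
qed

text \<open>This enumerates all nonempty countable sets of labelled reals by the reals themselves.\<close>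

lemma surj_real_to_sequences: "\<exists>T :: real \<Rightarrow> nat \<Rightarrow> real \<times> nat. surj T"
proof -
  obtain g :: "real \<Rightarrow> nat set" where g: "inj g"
    using nat_sets_eqpoll_reals eqpoll_sym unfolding eqpoll_def bij_betw_def by blast
  obtain h :: "nat set \<Rightarrow> real" where h: "inj h"
    using nat_sets_eqpoll_reals unfolding eqpoll_def bij_betw_def by blast
  define E :: "(nat \<Rightarrow> real \<times> nat) \<Rightarrow> (nat \<times> nat \<times> nat) set"
    where "E x = {(n, a, b). (a = 0 \<and> b \<in> g (fst (x n))) \<or> (a = 1 \<and> b = snd (x n))}" for x
  have "inj E"
  proof (rule injI)
    fix x y assume eq: "E x = E y"
    have iff: "(n, a, b) \<in> E x \<longleftrightarrow> (n, a, b) \<in> E y" for n a b using eq by simp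
    show "x = y"
    proof
      fix n
      have "g (fst (x n)) = g (fst (y n))" using iff[of n 0] by (auto simp: E_def)
      then have "fst (x n) = fst (y n)" using g by (auto dest: injD)
      moreover have "snd (x n) = snd (y n)" using iff[of n 1 "snd (x n)"] by (auto simp: E_def)
      ultimately show "x n = y n" by (rule prod_eqI)
    qed
  qed
  moreover have "inj (\<lambda>S :: (nat \<times> nat \<times> nat) set. to_nat ` S)"
    by (rule injI) (simp add: inj_image_eq_iff)
  ultimately have "inj (h \<circ> (\<lambda>S. to_nat ` S) \<circ> E)"
    using h by (intro inj_compose)
  then show ?thesis using inj_imp_surj_inv by blast
qed

section \<open>Germs\<close>

text \<open>The label function through \<open>(t, i)\<close>. The functions \<open>s t\<close> through the points labelled \<open>2\<close> are
  a parameter, since they are the object of the recursion.\<close>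

definition germ :: "(real \<Rightarrow> real \<Rightarrow> nat) \<Rightarrow> real \<Rightarrow> nat \<Rightarrow> real \<Rightarrow> nat"
  where "germ s t i u = (if i = 2 then s t u else if i = 1 \<and> u = t then 1 else 0)"

text \<open>At every point of \<open>A\<close>, the section agrees locally with the label function through its own value there. This is continuity of
  \<open>\<lambda>u. (u, f u)\<close> into the space whose charts are the graphs of the label functions, stated before
  that space exists.\<close>

definition continuous_section :: "(real \<Rightarrow> real \<Rightarrow> nat) \<Rightarrow> real set \<Rightarrow> (real \<Rightarrow> nat) \<Rightarrow> bool"
  where "continuous_section s A f \<longleftrightarrow> (\<forall>t\<in>A. \<forall>\<^sub>F u in nhds t. germ s t (f t) u = f u)"

text \<open>The countable sets that matter at stage \<open>r\<close>: their points have been built before, and they accumulate at \<open>r\<close>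
  in projection.\<close>

definition reachable :: "nat set \<Rightarrow> (real \<times> real) set \<Rightarrow> real \<Rightarrow> (real \<times> nat) set \<Rightarrow> bool"
  where "reachable Lab L r D \<longleftrightarrow>
    (\<forall>(t, i)\<in>D. i \<in> Lab \<and> (i = 2 \<longrightarrow> (t, r) \<in> L)) \<and> (\<exists>\<^sub>F t in at r. t \<in> fst ` D)"

text \<open>Continuity is demanded off \<open>r\<close> only: at \<open>r\<close> it holds by definition once \<open>f\<close> has become \<open>s r\<close>. The last
  clause meets every reachable set enumerated before \<open>r\<close>.\<close>

definition new_section :: "nat set \<Rightarrow> (real \<times> real) set \<Rightarrow> (real \<Rightarrow> nat \<Rightarrow> real \<times> nat) \<Rightarrow>
    (real \<Rightarrow> real \<Rightarrow> nat) \<Rightarrow> real \<Rightarrow> (real \<Rightarrow> nat) \<Rightarrow> bool"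
  where "new_section Lab L T s r f \<longleftrightarrow>
    f r = 2 \<and> (\<forall>t. t \<noteq> r \<longrightarrow> f t = 2 \<longrightarrow> (t, r) \<in> L) \<and> range f \<subseteq> Lab \<and>
    continuous_section s (- {r}) f \<and> countable {t. f t \<noteq> 0} \<and>
    (\<forall>q. (q, r) \<in> L \<longrightarrow> reachable Lab L r (range (T q)) \<longrightarrow>
       (\<exists>\<^sub>F t in at r. (t, f t) \<in> range (T q)))"

lemma germ_0: "germ s t 0 u = 0"
  by (simp add: germ_def)

lemma continuous_sectionD:
  "continuous_section s A f \<Longrightarrow> t \<in> A \<Longrightarrow> \<forall>\<^sub>F u in nhds t. germ s t (f t) u = f u"
  by (simp add: continuous_section_def)

lemma continuous_section_zero:
  assumes "continuous_section s A f" "t \<in> A" "f t = 0"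
  shows "\<forall>\<^sub>F u in nhds t. f u = 0"
  using continuous_sectionD[OF assms(1,2)] assms(3) by (auto elim!: eventually_mono simp: germ_0)

locale section_recursion =
  fixes Lab :: "nat set" and L :: "(real \<times> real) set" and T :: "real \<Rightarrow> nat \<Rightarrow> real \<times> nat"
  assumes Lab: "{0, 2} \<subseteq> Lab" "Lab \<subseteq> {0, 1, 2}"
    and L: "wf L" "trans L" "total L" "\<And>r. countable {t. (t, r) \<in> L}"
    and T: "surj T"
begin

lemma germ_of_label:
  assumes s: "i = 2 \<Longrightarrow> new_section Lab L T s t (s t)" and i: "i \<in> Lab"
  shows "germ s t i t = i" "range (germ s t i) \<subseteq> Lab" "continuous_section s UNIV (germ s t i)"
    "countable {u. germ s t i u \<noteq> 0}" "\<And>u. germ s t i u = 2 \<Longrightarrow> u = t \<and> i = 2 \<or> i = 2 \<and> (u, t) \<in> L"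
proof -
  consider "i = 0" | "i = 1" | "i = 2" using i Lab(2) by blast
  then have "germ s t i t = i \<and> range (germ s t i) \<subseteq> Lab \<and> continuous_section s UNIV (germ s t i) \<and>
    countable {u. germ s t i u \<noteq> 0} \<and> (\<forall>u. germ s t i u = 2 \<longrightarrow> u = t \<and> i = 2 \<or> i = 2 \<and> (u, t) \<in> L)"
  proof cases
    case 1
    have "germ s t 0 = (\<lambda>_. 0)" by (simp add: germ_def fun_eq_iff)
    then show ?thesis using Lab(1) 1 by (simp add: continuous_section_def germ_0)
  next
    case 2
    have eq: "germ s t (Suc 0) = (\<lambda>u. if u = t then 1 else 0)" by (simp add: germ_def fun_eq_iff)
    have "continuous_section s UNIV (germ s t (Suc 0))"
      unfolding continuous_section_def
    proof
      fix u
      show "\<forall>\<^sub>F v in nhds u. germ s u (germ s t (Suc 0) u) v = germ s t (Suc 0) v"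
      proof (cases "u = t")
        case False
        then have "\<forall>\<^sub>F v in nhds u. v \<noteq> t" by (rule t1_space_nhds)
        then show ?thesis
          by eventually_elim (use False in \<open>simp add: eq germ_0\<close>)
      qed (simp add: eq)
    qed
    then show ?thesis using Lab(1) i 2 by (auto simp: eq)
  next
    case 3
    have eq: "germ s t 2 = s t" by (simp add: germ_def fun_eq_iff)
    have n: "new_section Lab L T s t (s t)" using s 3 by simp
    then have tt: "s t t = 2" by (simp add: new_section_def)
    have "continuous_section s UNIV (s t)"
      unfolding continuous_section_def
    proof
      fix u
      show "\<forall>\<^sub>F v in nhds u. germ s u (s t u) v = s t v"
      proof (cases "u = t")
        case False
        have "continuous_section s (- {t}) (s t)" using n by (simp add: new_section_def)
        from continuous_sectionD[OF this] show ?thesis using False by simp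
      qed (simp add: tt eq)
    qed
    then show ?thesis using n 3 by (auto simp: eq new_section_def)
  qed
  then show "germ s t i t = i" "range (germ s t i) \<subseteq> Lab" "continuous_section s UNIV (germ s t i)"
    "countable {u. germ s t i u \<noteq> 0}" "\<And>u. germ s t i u = 2 \<Longrightarrow> u = t \<and> i = 2 \<or> i = 2 \<and> (u, t) \<in> L"
    by auto
qed

text \<open>A label function has countable support, so it vanishes at \<open>t + \<epsilon>\<close> and \<open>t - \<epsilon>\<close> for some arbitrarily small \<open>\<epsilon>\<close>; cutting
  it off there keeps it continuous, because a continuous section vanishes near each of its zeros.\<close>

lemma localized_section:
  assumes s: "\<And>t. (t, r) \<in> L \<Longrightarrow> new_section Lab L T s t (s t)"
    and ti: "i \<in> Lab" "i = 2 \<Longrightarrow> (t, r) \<in> L" and "0 < \<delta>"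
  shows "\<exists>g. g t = i \<and> (\<forall>u. g u \<noteq> 0 \<longrightarrow> \<bar>u - t\<bar> < \<delta>) \<and> continuous_section s UNIV g \<and>
    countable {u. g u \<noteq> 0} \<and> range g \<subseteq> Lab \<and> (\<forall>u. g u = 2 \<longrightarrow> (u, r) \<in> L)"
proof -
  define h where "h = germ s t i"
  have h: "h t = i" "range h \<subseteq> Lab" "continuous_section s UNIV h" "countable {u. h u \<noteq> 0}"
    "\<And>u. h u = 2 \<Longrightarrow> u = t \<and> i = 2 \<or> i = 2 \<and> (u, t) \<in> L"
    unfolding h_def by (rule germ_of_label; use s ti in blast)+
  have "countable ((\<lambda>u. u - t) ` {u. h u \<noteq> 0} \<union> (\<lambda>u. t - u) ` {u. h u \<noteq> 0})"
    using h(4) by auto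
  moreover have "uncountable {0<..<\<delta>}" using \<open>0 < \<delta>\<close> by (simp add: uncountable_open_interval)
  ultimately have "\<exists>\<epsilon>\<in>{0<..<\<delta>}. \<epsilon> \<notin> (\<lambda>u. u - t) ` {u. h u \<noteq> 0} \<union> (\<lambda>u. t - u) ` {u. h u \<noteq> 0}"
    by (intro uncountable_imp_not_subset_countable)
  then obtain \<epsilon> where \<epsilon>: "0 < \<epsilon>" "\<epsilon> < \<delta>"
    and nz: "\<epsilon> \<notin> (\<lambda>u. u - t) ` {u. h u \<noteq> 0}" "\<epsilon> \<notin> (\<lambda>u. t - u) ` {u. h u \<noteq> 0}" by auto
  have h0: "h (t + \<epsilon>) = 0" using nz(1) imageI[of "t + \<epsilon>" "{u. h u \<noteq> 0}" "\<lambda>u. u - t"] by auto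
  have h1: "h (t - \<epsilon>) = 0" using nz(2) imageI[of "t - \<epsilon>" "{u. h u \<noteq> 0}" "\<lambda>u. t - u"] by auto
  define g where "g u = (if \<bar>u - t\<bar> < \<epsilon> then h u else 0)" for u
  have "\<forall>\<^sub>F v in nhds u. germ s u (g u) v = g v" for u
  proof -
    consider "\<bar>u - t\<bar> < \<epsilon>" | "\<bar>u - t\<bar> > \<epsilon>" | "u = t + \<epsilon> \<or> u = t - \<epsilon>" by linarith
    then show ?thesis
    proof cases
      case 1
      have "open {v. \<bar>v - t\<bar> < \<epsilon>}" by (intro open_Collect_less continuous_intros)
      from eventually_nhds_in_open[OF this, of u] 1 have "\<forall>\<^sub>F v in nhds u. \<bar>v - t\<bar> < \<epsilon>" by simp
      moreover have "\<forall>\<^sub>F v in nhds u. germ s u (h u) v = h v"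
        using continuous_sectionD[OF h(3)] by simp
      ultimately show ?thesis
        by eventually_elim (use 1 in \<open>simp add: g_def\<close>)
    next
      case 2
      have "open {v. \<epsilon> < \<bar>v - t\<bar>}" by (intro open_Collect_less continuous_intros)
      from eventually_nhds_in_open[OF this, of u] 2 have "\<forall>\<^sub>F v in nhds u. \<epsilon> < \<bar>v - t\<bar>" by simp
      then show ?thesis
        by eventually_elim (use 2 in \<open>simp add: g_def germ_0\<close>)
    next
      case 3
      then have "h u = 0" "g u = 0" using h0 h1 by (auto simp: g_def)
      then show ?thesis
        using continuous_section_zero[OF h(3), of u] by (auto elim!: eventually_mono simp: g_def germ_0)
    qed
  qed
  then have "continuous_section s UNIV g" by (simp add: continuous_section_def)
  moreover have "g t = i" using \<epsilon>(1) h(1) by (simp add: g_def)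
  moreover have "\<forall>u. g u \<noteq> 0 \<longrightarrow> \<bar>u - t\<bar> < \<delta>" using \<epsilon>(2) by (auto simp: g_def)
  moreover have "countable {u. g u \<noteq> 0}"
    by (rule countable_subset[OF _ h(4)]) (auto simp: g_def)
  moreover have "range g \<subseteq> Lab" using h(2) Lab(1) by (auto simp: g_def)
  moreover have "(u, r) \<in> L" if "g u = 2" for u
  proof -
    have "h u = 2" using that by (simp add: g_def split: if_splits)
    from h(5)[OF this] show ?thesis using ti(2) transD[OF L(2)] by blast
  qed
  ultimately show ?thesis by blast
qed

lemma section_in_annulus:
  assumes s: "\<And>t. (t, r) \<in> L \<Longrightarrow> new_section Lab L T s t (s t)"
    and D: "reachable Lab L r D" and "0 < d"
  shows "\<exists>d' g. 0 < d' \<and> d' < d \<and> (\<forall>u. g u \<noteq> 0 \<longrightarrow> d' < \<bar>u - r\<bar> \<and> \<bar>u - r\<bar> < d) \<and>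
    (\<exists>t. d' < \<bar>t - r\<bar> \<and> \<bar>t - r\<bar> < d \<and> (t, g t) \<in> D) \<and> continuous_section s UNIV g \<and>
    countable {u. g u \<noteq> 0} \<and> range g \<subseteq> Lab \<and> (\<forall>u. g u = 2 \<longrightarrow> (u, r) \<in> L)"
proof -
  have "\<exists>\<^sub>F t in at r. t \<in> fst ` D" using D by (simp add: reachable_def)
  then obtain t where "t \<in> fst ` D" "t \<noteq> r" "dist t r < d"
    using \<open>0 < d\<close> unfolding frequently_at by blast
  then obtain i where ti: "(t, i) \<in> D" "0 < \<bar>t - r\<bar>" "\<bar>t - r\<bar> < d" by (auto simp: dist_real_def)
  then have i: "i \<in> Lab" "i = 2 \<Longrightarrow> (t, r) \<in> L" using D by (auto simp: reachable_def)
  \<comment> \<open>This keeps the support at distance between \<open>\<bar>t - r\<bar> / 2\<close> and \<open>d\<close> from \<open>r\<close>.\<close>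
  define \<delta> where "\<delta> = min (\<bar>t - r\<bar> / 2) (d - \<bar>t - r\<bar>)"
  have \<delta>: "0 < \<delta>" "\<delta> \<le> \<bar>t - r\<bar> / 2" "\<delta> \<le> d - \<bar>t - r\<bar>" using ti by (auto simp: \<delta>_def min_def)
  have "\<exists>g. g t = i \<and> (\<forall>u. g u \<noteq> 0 \<longrightarrow> \<bar>u - t\<bar> < \<delta>) \<and> continuous_section s UNIV g \<and>
    countable {u. g u \<noteq> 0} \<and> range g \<subseteq> Lab \<and> (\<forall>u. g u = 2 \<longrightarrow> (u, r) \<in> L)"
    by (rule localized_section) (fact s i \<delta>(1))+
  then obtain g where
    g: "g t = i" "\<forall>u. g u \<noteq> 0 \<longrightarrow> \<bar>u - t\<bar> < \<delta>" "continuous_section s UNIV g \<and>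
    countable {u. g u \<noteq> 0} \<and> range g \<subseteq> Lab \<and> (\<forall>u. g u = 2 \<longrightarrow> (u, r) \<in> L)"
    by (elim exE conjE) (rule that; (intro conjI)?; assumption)
  have "\<forall>u. g u \<noteq> 0 \<longrightarrow> \<bar>t - r\<bar> / 2 < \<bar>u - r\<bar> \<and> \<bar>u - r\<bar> < d"
  proof (intro allI impI)
    fix u assume "g u \<noteq> 0"
    then have "\<bar>u - t\<bar> < \<delta>" using g(2) by blast
    then show "\<bar>t - r\<bar> / 2 < \<bar>u - r\<bar> \<and> \<bar>u - r\<bar> < d"
      using \<delta> abs_triangle_ineq[of "u - t" "t - r"] abs_triangle_ineq[of "t - u" "u - r"]
      by (simp add: abs_minus_commute)
  qed
  moreover have "\<bar>t - r\<bar> / 2 < \<bar>t - r\<bar>" "0 < \<bar>t - r\<bar> / 2" "\<bar>t - r\<bar> / 2 < d" "(t, g t) \<in> D"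
    using ti g(1) by auto
  ultimately show ?thesis using ti(3) g(3) by blast
qed

text \<open>The sets to be met at \<open>r\<close> are countably many; they are listed so that each occurs infinitely often. Choose successively
  disjoint annuli around \<open>r\<close> shrinking to \<open>r\<close>, and in the \<open>n\<close>-th one a section that is supported there
  and runs through a point of the \<open>n\<close>-th set. The sections are glued, with label \<open>2\<close> at \<open>r\<close>. Away from
  \<open>r\<close> the supports are locally finite, so the result is continuous there.\<close>

lemma ex_new_section:
  assumes s: "\<And>t. (t, r) \<in> L \<Longrightarrow> new_section Lab L T s t (s t)"
  shows "\<exists>f. new_section Lab L T s r f"
proof -
  define Q where "Q = {q. (q, r) \<in> L \<and> reachable Lab L r (range (T q))}"
  have "countable Q" by (rule countable_subset[OF _ L(4)[of r]]) (auto simp: Q_def)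
  show ?thesis
  proof (cases "Q = {}")
    case True
    define f :: "real \<Rightarrow> nat" where "f t = (if t = r then 2 else 0)" for t
    have "\<forall>\<^sub>F u in nhds t. germ s t (f t) u = f u" if "t \<noteq> r" for t
      using t1_space_nhds[OF that] by eventually_elim (use that in \<open>simp add: f_def germ_0\<close>)
    then have "continuous_section s (- {r}) f" by (simp add: continuous_section_def)
    moreover have "range f \<subseteq> Lab" using Lab(1) by (auto simp: f_def)
    moreover have "{t. f t \<noteq> 0} = {r}" by (auto simp: f_def)
    moreover have "\<not> reachable Lab L r (range (T q))" if "(q, r) \<in> L" for q
      using True that by (auto simp: Q_def)
    ultimately have "new_section Lab L T s r f"
      unfolding new_section_def by (simp add: f_def)
    then show ?thesis by (intro exI[of _ f])
  next
    case False
    define task where "task n = from_nat_into Q (fst (prod_decode n))" for n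
    have task: "task n \<in> Q" for n using False by (simp add: task_def from_nat_into)
    have task_inf: "\<exists>n\<ge>m. task n = q" if q: "q \<in> Q" for q m
    proof -
      obtain a where "from_nat_into Q a = q" using from_nat_into_surj[OF \<open>countable Q\<close> q] by blast
      then have "task (prod_encode (a, m)) = q" by (simp add: task_def)
      then show ?thesis using le_prod_encode_2 by blast
    qed
    \<comment> \<open>\<open>(d, d', g)\<close>: the annulus has radii \<open>d' < d\<close>, and \<open>g\<close> is the section supported in it.\<close>
    define good where "good n x \<longleftrightarrow> (case x of (d, d', g) \<Rightarrow>
      0 < d' \<and> d' < d \<and> d \<le> inverse (real (Suc n)) \<and>
      (\<forall>u. g u \<noteq> 0 \<longrightarrow> d' < \<bar>u - r\<bar> \<and> \<bar>u - r\<bar> < d) \<and>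
      (\<exists>t. d' < \<bar>t - r\<bar> \<and> \<bar>t - r\<bar> < d \<and> (t, g t) \<in> range (T (task n))) \<and> continuous_section s UNIV g \<and>
      countable {u. g u \<noteq> 0} \<and> range g \<subseteq> Lab \<and> (\<forall>u. g u = 2 \<longrightarrow> (u, r) \<in> L))"
      for n :: nat and x :: "real \<times> real \<times> (real \<Rightarrow> nat)"
    have ex_good: "\<exists>x. good n x \<and> fst x \<le> e" if "0 < e" for n e
    proof -
      define d where "d = min e (inverse (real (Suc n)))"
      have "0 < d" using that by (simp add: d_def)
      moreover have "reachable Lab L r (range (T (task n)))" using task[of n] by (simp add: Q_def)
      ultimately obtain d' g where "good n (d, d', g)"
        using section_in_annulus[where s = s and r = r and D = "range (T (task n))" and d = d] s
        unfolding good_def prod.case by (auto simp: d_def)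
      then show ?thesis by (intro exI[of _ "(d, d', g)"]) (simp add: d_def)
    qed
    have "\<exists>F. \<forall>n. good n (F n) \<and> fst (F (Suc n)) \<le> fst (snd (F n))"
    proof (rule dependent_nat_choice)
      show "\<exists>x. good 0 x" using ex_good[of 1 0] by auto
      fix x n assume "good n x"
      then have "0 < fst (snd x)" by (auto simp: good_def)
      then show "\<exists>y. good (Suc n) y \<and> fst y \<le> fst (snd x)" by (rule ex_good)
    qed
    then obtain F where F: "\<And>n. good n (F n)" "\<And>n. fst (F (Suc n)) \<le> fst (snd (F n))" by auto
    define d where "d n = fst (F n)" for n
    define d' where "d' n = fst (snd (F n))" for n
    define g where "g n = snd (snd (F n))" for n
    have g: "0 < d' n" "d' n < d n" "d n \<le> inverse (real (Suc n))"
      "\<And>u. g n u \<noteq> 0 \<Longrightarrow> d' n < \<bar>u - r\<bar> \<and> \<bar>u - r\<bar> < d n"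
      "\<exists>t. d' n < \<bar>t - r\<bar> \<and> \<bar>t - r\<bar> < d n \<and> (t, g n t) \<in> range (T (task n))"
      "continuous_section s UNIV (g n)" "countable {u. g n u \<noteq> 0}" "range (g n) \<subseteq> Lab"
      "\<And>u. g n u = 2 \<Longrightarrow> (u, r) \<in> L" for n
      using F(1)[of n] by (auto simp: good_def d_def d'_def g_def case_prod_beta)
    have step: "d (Suc n) \<le> d' n" for n using F(2) by (simp add: d_def d'_def)
    have "decseq d" using step g(2) by (intro decseq_SucI) (meson less_imp_le order_trans)
    have disjoint: "m = n" if "d' m < x" "x < d m" "d' n < x" "x < d n" for m n x
    proof -
      have "\<not> m < n" if "d' m < x" "x < d n" for m n
      proof
        assume "m < n"
        then have "d n \<le> d (Suc m)" using \<open>decseq d\<close> by (simp add: decseq_def)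
        then show False using step[of m] that by linarith
      qed
      then show ?thesis using that by (meson nat_neq_iff)
    qed
    \<comment> \<open>The annuli are disjoint, so at most one \<open>g n\<close> is nonzero at \<open>u\<close>.\<close>
    define f where "f u = (if u = r then 2 else if \<exists>n. g n u \<noteq> 0 then g (SOME n. g n u \<noteq> 0) u else 0)" for u
    have f_r: "f r = 2" by (simp add: f_def)
    have f_zero: "f u = 0" if "u \<noteq> r" "\<And>n. g n u = 0" for u using that by (simp add: f_def)
    have f_annulus: "f u = g n u" if un: "d' n < \<bar>u - r\<bar>" "\<bar>u - r\<bar> < d n" for u n
    proof -
      have other: "g m u = 0" if "m \<noteq> n" for m
        using disjoint[of m "\<bar>u - r\<bar>" n] g(4)[of m u] that un by blast
      have "u \<noteq> r" using un g(1)[of n] by auto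
      show ?thesis
      proof (cases "g n u = 0")
        case True
        then have "g m u = 0" for m using other by (cases "m = n") auto
        then show ?thesis using f_zero[OF \<open>u \<noteq> r\<close>] True by simp
      next
        case False
        moreover have "m = n" if "g m u \<noteq> 0" for m using other[of m] that by (cases "m = n") simp_all
        ultimately have "(SOME m. g m u \<noteq> 0) = n" by (rule some_equality)
        then show ?thesis using False \<open>u \<noteq> r\<close> by (auto simp: f_def)
      qed
    qed
    have f_cases: "f u = 0 \<or> (\<exists>n. f u = g n u)" if "u \<noteq> r" for u
      using that by (auto simp: f_def)
    have "\<forall>\<^sub>F u in nhds t. germ s t (f t) u = f u" if "t \<noteq> r" for t
    proof (cases "\<exists>n. d' n < \<bar>t - r\<bar> \<and> \<bar>t - r\<bar> < d n")
      case True
      then obtain n where n: "d' n < \<bar>t - r\<bar>" "\<bar>t - r\<bar> < d n" by blast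
      have "open {u. d' n < \<bar>u - r\<bar> \<and> \<bar>u - r\<bar> < d n}"
        by (intro open_Collect_conj open_Collect_less continuous_intros)
      from eventually_nhds_in_open[OF this, of t] n
      have "\<forall>\<^sub>F u in nhds t. d' n < \<bar>u - r\<bar> \<and> \<bar>u - r\<bar> < d n" by simp
      moreover have "\<forall>\<^sub>F u in nhds t. germ s t (g n t) u = g n u"
        using continuous_sectionD[OF g(6)] by simp
      ultimately show ?thesis
      proof eventually_elim
        case (elim u)
        then show ?case using f_annulus[of n u] f_annulus[of n t] n by simp
      qed
    next
      case False
      then have g0: "g n t = 0" for n using g(4) by blast
      have "0 < \<bar>t - r\<bar>" using that by simp
      \<comment> \<open>Only the first \<open>K\<close> sections can be nonzero near \<open>t\<close>.\<close>
      then obtain K where "inverse (real (Suc K)) < \<bar>t - r\<bar>" using reals_Archimedean by blast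
      then have K: "d K < \<bar>t - r\<bar>" using g(3)[of K] by linarith
      have "open {u. d K < \<bar>u - r\<bar>}" by (intro open_Collect_less continuous_intros)
      from eventually_nhds_in_open[OF this, of t] K have 1: "\<forall>\<^sub>F u in nhds t. d K < \<bar>u - r\<bar>" by simp
      have 2: "\<forall>\<^sub>F u in nhds t. \<forall>n\<in>{..<K}. g n u = 0"
        by (intro eventually_ball_finite ballI continuous_section_zero[OF g(6)]) (simp_all add: g0)
      from 1 2 have "\<forall>\<^sub>F u in nhds t. f u = 0"
      proof eventually_elim
        case (elim u)
        have "g n u = 0" for n
        proof (cases "n < K")
          case False
          then have "d n \<le> d K" using \<open>decseq d\<close> by (simp add: decseq_def)
          then show ?thesis using elim(1) g(4)[of n u] by fastforce
        qed (use elim(2) in simp)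
        moreover have "u \<noteq> r" using elim(1) g(1,2)[of K] by auto
        ultimately show ?case using f_zero by blast
      qed
      moreover have "f t = 0" using f_zero that g0 by blast
      ultimately show ?thesis by (simp add: germ_0 eventually_mono)
    qed
    then have "continuous_section s (- {r}) f" by (simp add: continuous_section_def)
    moreover have "(t, r) \<in> L" if "t \<noteq> r" "f t = 2" for t
      using f_cases[OF that(1)] that(2) g(9) by auto
    moreover have "range f \<subseteq> Lab"
    proof
      fix i assume "i \<in> range f"
      then obtain u where "i = f u" by blast
      then show "i \<in> Lab" using f_cases[of u] f_r Lab(1) g(8) by (cases "u = r") auto
    qed
    moreover have "countable {t. f t \<noteq> 0}"
    proof (rule countable_subset)
      show "{t. f t \<noteq> 0} \<subseteq> insert r (\<Union>n. {u. g n u \<noteq> 0})"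
      proof
        fix t assume "t \<in> {t. f t \<noteq> 0}"
        then show "t \<in> insert r (\<Union>n. {u. g n u \<noteq> 0})" using f_cases[of t] by (cases "t = r") auto
      qed
      show "countable (insert r (\<Union>n. {u. g n u \<noteq> 0}))" using g(7) by auto
    qed
    moreover have "\<exists>\<^sub>F t in at r. (t, f t) \<in> range (T q)"
      if q: "(q, r) \<in> L" "reachable Lab L r (range (T q))" for q
      unfolding frequently_at
    proof (intro allI impI)
      fix e :: real assume "0 < e"
      then obtain m where m: "inverse (real (Suc m)) < e" using reals_Archimedean by blast
      obtain n where n: "m \<le> n" "task n = q" using task_inf[of q m] q by (auto simp: Q_def)
      obtain t where t: "d' n < \<bar>t - r\<bar>" "\<bar>t - r\<bar> < d n" "(t, g n t) \<in> range (T q)"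
        using g(5)[of n] n(2) by blast
      have "d n \<le> d m" using \<open>decseq d\<close> n(1) by (simp add: decseq_def)
      then have "\<bar>t - r\<bar> < e" using t(2) m g(3)[of m] by linarith
      moreover have "t \<noteq> r" using t(1) g(1)[of n] by auto
      moreover have "f t = g n t" using f_annulus t by blast
      ultimately show "\<exists>t\<in>UNIV. t \<noteq> r \<and> dist t r < e \<and> (t, f t) \<in> range (T q)"
        using t(3) by (auto simp: dist_real_def)
    qed
    ultimately have "new_section Lab L T s r f"
      unfolding new_section_def using f_r by blast
    then show ?thesis by (intro exI[of _ f])
  qed
qed

text \<open>The conditions at stage \<open>r\<close> see only earlier stages, which is what recursion along \<open>L\<close> needs.\<close>

lemma new_section_cong:
  assumes "\<And>t. (t, r) \<in> L \<Longrightarrow> s t = s' t"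
  shows "new_section Lab L T s r f = new_section Lab L T s' r f"
proof (cases "\<forall>t. t \<noteq> r \<longrightarrow> f t = 2 \<longrightarrow> (t, r) \<in> L")
  case True
  then have "germ s t (f t) = germ s' t (f t)" if "t \<noteq> r" for t
    using assms that by (auto simp: germ_def fun_eq_iff)
  then have "continuous_section s (- {r}) f = continuous_section s' (- {r}) f"
    by (auto simp: continuous_section_def)
  then show ?thesis by (simp add: new_section_def)
qed (auto simp: new_section_def)

lemma ex_sections: "\<exists>s. \<forall>r. new_section Lab L T s r (s r)"
  by (rule dependent_wf_choice[OF L(1)]) (erule new_section_cong, erule ex_new_section)

end

lemma Euclidean_space_1_homeomorphic_euclideanreal:
  "euclideanreal homeomorphic_space Euclidean_space 1"
  unfolding homeomorphic_space_def homeomorphic_maps_def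
proof (intro exI conjI ballI)
  show "continuous_map euclideanreal (Euclidean_space 1) (\<lambda>x i. if i < 1 then x else 0)"
    by (subst continuous_map_componentwise_Euclidean_space) simp
  show "continuous_map (Euclidean_space 1) euclideanreal (\<lambda>f. f 0)"
    unfolding Euclidean_space_def
    by (intro continuous_map_from_subtopology continuous_map_product_projection) simp
  show "(\<lambda>i. if i < 1 then y 0 else 0) = y" if "y \<in> topspace (Euclidean_space 1)" for y :: "nat \<Rightarrow> real"
    using that by (auto simp: topspace_Euclidean_space fun_eq_iff not_less)
qed simp

section \<open>The line of germs\<close>

text \<open>A family of label functions satisfying these conditions consists of the sections of a non-Hausdorff
  line. The points \<open>(t, i)\<close> are coded as elements \<open>pt t i\<close> of an arbitrary type, so that the space can be placed on a
  prescribed carrier type.\<close>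

locale germ_line =
  fixes pt :: "real \<Rightarrow> nat \<Rightarrow> 'p" and pos :: "'p \<Rightarrow> real" and lab :: "'p \<Rightarrow> nat"
    and Lab :: "nat set" and sec :: "real \<Rightarrow> nat \<Rightarrow> real \<Rightarrow> nat"
  assumes pos_pt [simp]: "pos (pt t i) = t" and lab_pt [simp]: "lab (pt t i) = i"
    and zero_Lab: "0 \<in> Lab" and nonzero_Lab: "\<exists>i\<in>Lab. i \<noteq> 0"
    and sec_0: "sec t 0 u = 0"
    and sec_self: "i \<in> Lab \<Longrightarrow> sec t i t = i"
    and sec_Lab: "i \<in> Lab \<Longrightarrow> sec t i u \<in> Lab"
    and sec_coherent: "i \<in> Lab \<Longrightarrow> \<forall>\<^sub>F v in nhds u. sec u (sec t i u) v = sec t i v"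
    and sec_countable: "i \<in> Lab \<Longrightarrow> countable {u. sec t i u \<noteq> 0}"
begin

definition points :: "'p set"
  where "points = (\<lambda>(t, i). pt t i) ` (UNIV \<times> Lab)"

definition germ_open :: "'p set \<Rightarrow> bool"
  where "germ_open W \<longleftrightarrow> W \<subseteq> points \<and>
    (\<forall>p\<in>W. \<forall>\<^sub>F u in nhds (pos p). pt u (sec (pos p) (lab p) u) \<in> W)"

definition germ_space :: "'p topology"
  where "germ_space = topology germ_open"

lemma pt_in_points [simp]: "pt t i \<in> points \<longleftrightarrow> i \<in> Lab"
  unfolding points_def by (force dest: arg_cong[where f = lab])

lemma pointsE:
  assumes "p \<in> points"
  obtains t i where "p = pt t i" "i \<in> Lab"
  using assms unfolding points_def by auto

lemma pt_eq_iff [simp]: "pt t i = pt u j \<longleftrightarrow> t = u \<and> i = j"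
  by (metis pos_pt lab_pt)

lemma openin_germ_space: "openin germ_space W \<longleftrightarrow> germ_open W"
proof -
  have "istopology germ_open"
    unfolding istopology_def
  proof (intro conjI allI impI)
    fix S T assume "germ_open S" "germ_open T"
    then show "germ_open (S \<inter> T)" by (auto simp: germ_open_def eventually_conj)
  next
    fix \<K> assume \<K>: "\<forall>K\<in>\<K>. germ_open K"
    show "germ_open (\<Union>\<K>)"
      unfolding germ_open_def
    proof (intro conjI ballI)
      show "\<Union>\<K> \<subseteq> points" using \<K> by (auto simp: germ_open_def)
      fix p assume "p \<in> \<Union>\<K>"
      then obtain K where K: "K \<in> \<K>" "p \<in> K" by blast
      then have "\<forall>\<^sub>F u in nhds (pos p). pt u (sec (pos p) (lab p) u) \<in> K"
        using \<K> by (auto simp: germ_open_def)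
      then show "\<forall>\<^sub>F u in nhds (pos p). pt u (sec (pos p) (lab p) u) \<in> \<Union>\<K>"
        by eventually_elim (use K in blast)
    qed
  qed
  then show ?thesis by (simp add: germ_space_def topology_inverse')
qed

lemma openin_germ_space_nhds:
  assumes "openin germ_space W" "pt t i \<in> W"
  shows "\<forall>\<^sub>F u in nhds t. pt u (sec t i u) \<in> W"
proof -
  have "\<forall>p\<in>W. \<forall>\<^sub>F u in nhds (pos p). pt u (sec (pos p) (lab p) u) \<in> W"
    using assms(1) by (simp add: openin_germ_space germ_open_def)
  from bspec[OF this assms(2)] show ?thesis by simp
qed

definition graph :: "real \<Rightarrow> nat \<Rightarrow> 'p set"
  where "graph t i = range (\<lambda>u. pt u (sec t i u))"

lemma openin_graph_over:
  assumes "i \<in> Lab" "open J"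
  shows "openin germ_space ((\<lambda>u. pt u (sec t i u)) ` J)"
  unfolding openin_germ_space germ_open_def
proof (intro conjI ballI)
  show "(\<lambda>u. pt u (sec t i u)) ` J \<subseteq> points" using sec_Lab[OF assms(1)] by auto
  fix p assume "p \<in> (\<lambda>u. pt u (sec t i u)) ` J"
  then obtain u where u: "u \<in> J" "p = pt u (sec t i u)" by blast
  have "\<forall>\<^sub>F v in nhds u. v \<in> J" using assms(2) u(1) by (rule eventually_nhds_in_open)
  with sec_coherent[OF assms(1), of u t]
  show "\<forall>\<^sub>F v in nhds (pos p). pt v (sec (pos p) (lab p) v) \<in> (\<lambda>u. pt u (sec t i u)) ` J"
    unfolding u(2) pos_pt lab_pt by eventually_elim auto
qed

lemma topspace_germ_space [simp]: "topspace germ_space = points"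
proof
  show "topspace germ_space \<subseteq> points"
    using iffD1[OF openin_germ_space openin_topspace] unfolding germ_open_def by blast
  show "points \<subseteq> topspace germ_space"
  proof
    fix p assume "p \<in> points"
    then obtain t i where p: "p = pt t i" "i \<in> Lab" by (rule pointsE)
    have "p \<in> (\<lambda>u. pt u (sec t i u)) ` UNIV"
      by (rule image_eqI[of _ _ t]) (simp_all add: p sec_self)
    then show "p \<in> topspace germ_space"
      using openin_subset[OF openin_graph_over[OF p(2) open_UNIV, of t]] by blast
  qed
qed

lemma continuous_map_pos: "continuous_map germ_space euclideanreal pos"
  unfolding continuous_map_def
proof (intro conjI allI impI)
  fix U :: "real set" assume "openin euclideanreal U"
  then have "open U" by simp
  have "germ_open {x \<in> points. pos x \<in> U}"
    unfolding germ_open_def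
  proof (intro conjI ballI)
    fix p assume "p \<in> {x \<in> points. pos x \<in> U}"
    then have "pos p \<in> U" "lab p \<in> Lab" by (auto elim!: pointsE)
    from eventually_nhds_in_open[OF \<open>open U\<close> this(1)]
    show "\<forall>\<^sub>F u in nhds (pos p). pt u (sec (pos p) (lab p) u) \<in> {x \<in> points. pos x \<in> U}"
      by eventually_elim (simp add: sec_Lab \<open>lab p \<in> Lab\<close>)
  qed auto
  then show "openin germ_space {x \<in> topspace germ_space. pos x \<in> U}" by (simp add: openin_germ_space)
qed simp

lemma continuous_map_section:
  assumes "i \<in> Lab"
  shows "continuous_map euclideanreal germ_space (\<lambda>u. pt u (sec t i u))"
  unfolding continuous_map_def
proof (intro conjI allI impI)
  show "(\<lambda>u. pt u (sec t i u)) \<in> topspace euclideanreal \<rightarrow> topspace germ_space"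
    using sec_Lab[OF assms] by auto
  fix W assume W: "openin germ_space W"
  have "open {u. pt u (sec t i u) \<in> W}"
    unfolding open_subopen[of "{u. pt u (sec t i u) \<in> W}"]
  proof (intro ballI)
    fix u assume "u \<in> {u. pt u (sec t i u) \<in> W}"
    then have "\<forall>\<^sub>F v in nhds u. pt v (sec u (sec t i u) v) \<in> W"
      using openin_germ_space_nhds[OF W] by simp
    with sec_coherent[OF assms, of u t] have "\<forall>\<^sub>F v in nhds u. pt v (sec t i v) \<in> W"
      by eventually_elim simp
    then show "\<exists>T. open T \<and> u \<in> T \<and> T \<subseteq> {u. pt u (sec t i u) \<in> W}"
      unfolding eventually_nhds by blast
  qed
  then show "openin euclideanreal {x \<in> topspace euclideanreal. pt x (sec t i x) \<in> W}" by simp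
qed

lemma graph_homeomorphic_line:
  assumes "i \<in> Lab"
  shows "subtopology germ_space (graph t i) homeomorphic_space euclideanreal"
  unfolding homeomorphic_space_def homeomorphic_maps_def
proof (intro exI conjI ballI)
  show "continuous_map (subtopology germ_space (graph t i)) euclideanreal pos"
    by (rule continuous_map_from_subtopology[OF continuous_map_pos])
  show "continuous_map euclideanreal (subtopology germ_space (graph t i)) (\<lambda>u. pt u (sec t i u))"
    using continuous_map_section[OF assms] by (auto simp: continuous_map_in_subtopology graph_def)
  show "pt (pos x) (sec t i (pos x)) = x" if "x \<in> topspace (subtopology germ_space (graph t i))" for x
    using that by (auto simp: graph_def)
qed simp

text \<open>Any chart agrees with the zero section off a countable set, and no neighbourhood on the line is
  countable. Both connectedness and the failure of separation come from this.\<close>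

lemma openin_meets_zero_section:
  assumes W: "openin germ_space W" "pt t i \<in> W" and ev: "\<forall>\<^sub>F u in nhds t. P u"
  shows "\<exists>u. P u \<and> pt u 0 \<in> W"
proof -
  have i: "i \<in> Lab" using openin_subset[OF W(1)] W(2) by auto
  from openin_germ_space_nhds[OF W] ev have "\<forall>\<^sub>F u in nhds t. pt u (sec t i u) \<in> W \<and> P u"
    by (rule eventually_conj)
  then obtain e where e: "0 < e" "\<forall>u. dist u t < e \<longrightarrow> pt u (sec t i u) \<in> W \<and> P u"
    unfolding eventually_nhds_metric by blast
  have "uncountable (ball t e)" using e(1) by (rule uncountable_ball)
  then have "\<exists>u\<in>ball t e. u \<notin> {u. sec t i u \<noteq> 0}"
    by (rule uncountable_imp_not_subset_countable[OF _ sec_countable[OF i]])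
  then obtain u where "dist u t < e" "sec t i u = 0" by (auto simp: dist_commute)
  then show ?thesis using e(2) by force
qed

lemma not_separated_from_zero_section: "\<not> separated_points germ_space (pt t 0) (pt t i)"
proof
  assume "separated_points germ_space (pt t 0) (pt t i)"
  then obtain U V where UV: "openin germ_space U" "openin germ_space V" "pt t 0 \<in> U" "pt t i \<in> V" "disjnt U V"
    unfolding separated_points_def by blast
  have "\<forall>\<^sub>F u in nhds t. pt u 0 \<in> U"
    using openin_germ_space_nhds[OF UV(1,3)] by (simp add: sec_0)
  from openin_meets_zero_section[OF UV(2,4) this] show False
    using UV(5) by (auto simp: disjnt_iff)
qed

lemma connected_germ_space: "connected_space germ_space"
proof -
  let ?Z = "range (\<lambda>u. pt u 0)"
  have "continuous_map euclideanreal germ_space (\<lambda>u. pt u 0)"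
    using continuous_map_section[OF zero_Lab] by (simp add: sec_0)
  then have "connectedin germ_space (id ?Z)"
    using connectedin_continuous_map_image[of euclideanreal germ_space "\<lambda>u. pt u 0" UNIV] by simp
  moreover have "germ_space closure_of ?Z = points"
  proof
    show "germ_space closure_of ?Z \<subseteq> points" using closure_of_subset_topspace[of germ_space] by simp
    show "points \<subseteq> germ_space closure_of ?Z"
    proof
      fix p assume p: "p \<in> points"
      then obtain t i where ti: "p = pt t i" by (rule pointsE)
      have "\<exists>y. y \<in> ?Z \<and> y \<in> W" if W: "p \<in> W" "openin germ_space W" for W
      proof -
        have "\<exists>u. True \<and> pt u 0 \<in> W"
          by (rule openin_meets_zero_section[OF W(2)]) (use W(1) ti in auto)
        then show ?thesis by blast
      qed
      then show "p \<in> germ_space closure_of ?Z" using p by (auto simp: in_closure_of)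
    qed
  qed
  ultimately have "connectedin germ_space points"
    using connectedin_closure_of[of germ_space ?Z] by simp
  then show ?thesis using connectedin_topspace[of germ_space] by simp
qed

lemma ENH_manifold_germ_space: "ENH_manifold germ_space"
proof -
  have "\<exists>N U. openin germ_space U \<and> x \<in> U \<and> U \<subseteq> N \<and> N \<subseteq> topspace germ_space \<and>
    subtopology germ_space N homeomorphic_space Euclidean_space 1" if "x \<in> points" for x
  proof -
    obtain t i where ti: "x = pt t i" "i \<in> Lab" using \<open>x \<in> points\<close> by (rule pointsE)
    have op: "openin germ_space (graph t i)"
      unfolding graph_def by (rule openin_graph_over[OF ti(2) open_UNIV])
    have "x \<in> graph t i"
      unfolding graph_def by (rule image_eqI[of _ _ t]) (simp_all add: ti sec_self)
    moreover have "subtopology germ_space (graph t i) homeomorphic_space Euclidean_space 1"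
      using graph_homeomorphic_line[OF ti(2)] Euclidean_space_1_homeomorphic_euclideanreal
      by (rule homeomorphic_space_trans)
    ultimately show ?thesis using op openin_subset[OF op] by blast
  qed
  moreover have "points \<noteq> {}" using zero_Lab pt_in_points[of 0 0] by blast
  ultimately have "manifold germ_space"
    unfolding manifold_def using connected_germ_space by (intro conjI exI[of _ 1]) auto
  moreover have "everywhere_non_Hausdorff germ_space"
    unfolding everywhere_non_Hausdorff_def
  proof
    fix x assume "x \<in> topspace germ_space"
    then obtain t i where ti: "x = pt t i" "i \<in> Lab" by (auto elim: pointsE)
    have sym: "separated_points germ_space a b \<longleftrightarrow> separated_points germ_space b a" for a b
      unfolding separated_points_def by (metis disjnt_sym)
    show "NH germ_space x \<noteq> {}"
    proof (cases "i = 0")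
      case True
      obtain j where "j \<in> Lab" "j \<noteq> 0" using nonzero_Lab by blast
      then have "pt t j \<in> NH germ_space x"
        using not_separated_from_zero_section[of t j] True ti by (simp add: NH_def)
      then show ?thesis by blast
    next
      case False
      then have "pt t 0 \<in> NH germ_space x"
        using not_separated_from_zero_section[of t i] sym ti zero_Lab by (simp add: NH_def)
      then show ?thesis by blast
    qed
  qed
  ultimately show ?thesis by (simp add: ENH_manifold_def)
qed

end

section \<open>Germ lines without large closed discrete sets\<close>

locale accumulating_germ_line = section_recursion Lab L T + germ_line pt pos lab Lab "germ s"
  for pt :: "real \<Rightarrow> nat \<Rightarrow> 'p" and pos lab Lab L T s +
  assumes new_section: "\<And>r. new_section Lab L T s r (s r)"
begin

text \<open>\<open>B\<close> collects the projection of \<open>D\<close>, the positions up to those of \<open>D\<close>, and the stages up to the one whose task enumerates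
  \<open>D\<close>. Every other \<open>r\<close> in the closure is a limit of the projection and is treated after all of these, so the section
  built at \<open>r\<close> was made to run through points of \<open>D\<close> near \<open>r\<close>.\<close>

lemma countable_exceptions_to_accumulation:
  assumes D: "countable D" "D \<subseteq> points"
  shows "\<exists>B. countable B \<and> (\<forall>r W. r \<notin> B \<longrightarrow> r \<in> closure (pos ` D) \<longrightarrow> openin germ_space W \<longrightarrow>
    pt r 2 \<in> W \<longrightarrow> (\<exists>p\<in>D \<inter> W. p \<noteq> pt r 2))"
proof (cases "D = {}")
  case False
  define x where "x n = (pos (from_nat_into D n), lab (from_nat_into D n))" for n
  have "range x = (\<lambda>p. (pos p, lab p)) ` range (from_nat_into D)"
    by (simp add: x_def[abs_def] image_image)
  then have range_x: "range x = (\<lambda>p. (pos p, lab p)) ` D"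
    by (simp add: range_from_nat_into[OF False D(1)])
  obtain q where q: "T q = x" using T by (metis surjD)
  define B where "B = pos ` D \<union> (\<Union>b\<in>insert q (pos ` D). insert b {t. (t, b) \<in> L})"
  have "countable B"
    unfolding B_def using D(1) L(4) by (intro countable_Un countable_UN countable_insert) auto
  moreover have "\<exists>p\<in>D \<inter> W. p \<noteq> pt r 2"
    if r: "r \<notin> B" "r \<in> closure (pos ` D)" and W: "openin germ_space W" "pt r 2 \<in> W" for r W
  proof -
    have below: "(b, r) \<in> L" if "b \<in> insert q (pos ` D)" for b
    proof -
      have "r \<noteq> b" "(r, b) \<notin> L" using r(1) that by (auto simp: B_def)
      then show ?thesis using L(3) unfolding total_on_def by auto
    qed
    have "r islimpt pos ` D" using r by (auto simp: B_def closure_def)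
    then have "\<exists>\<^sub>F t in at r. t \<in> pos ` D"
      unfolding islimpt_iff_eventually frequently_def by simp
    then have "reachable Lab L r (range (T q))"
      unfolding q range_x reachable_def using D(2) below
      by (auto simp: image_image elim!: pointsE)
    then have "\<exists>\<^sub>F t in at r. (t, s r t) \<in> range (T q)"
      using new_section[of r] below unfolding new_section_def by blast
    moreover have "\<forall>\<^sub>F u in at r. pt u (germ s r 2 u) \<in> W"
      using openin_germ_space_nhds[OF W] by (simp add: eventually_nhds_conv_at)
    ultimately have "\<exists>\<^sub>F t in at r. pt t (germ s r 2 t) \<in> W \<and> (t, s r t) \<in> range (T q)"
      by (rule frequently_eventually_conj)
    moreover have "\<forall>\<^sub>F t in at r. t \<noteq> r" by (simp add: eventually_at_filter)
    ultimately have "\<exists>\<^sub>F t in at r. t \<noteq> r \<and> pt t (germ s r 2 t) \<in> W \<and> (t, s r t) \<in> range (T q)"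
      by (rule frequently_eventually_conj)
    then obtain t where t: "(t, s r t) \<in> range (T q)" "pt t (germ s r 2 t) \<in> W" "t \<noteq> r"
      by (blast dest: frequently_ex)
    from t(1) obtain p where p: "p \<in> D" "t = pos p" "s r t = lab p" unfolding q range_x by auto
    have "p = pt t (s r t)" using p D(2) by (auto elim!: pointsE)
    then have "p \<in> W" "p \<noteq> pt r 2" using t(2,3) by (auto simp: germ_def)
    then show ?thesis using p(1) by blast
  qed
  ultimately show ?thesis by blast
qed (intro exI[of _ "{}"], simp)

lemma ex_countable_dense_positions:
  assumes "A \<subseteq> points"
  shows "\<exists>D. countable D \<and> D \<subseteq> {p \<in> A. lab p = i} \<and> (\<forall>p\<in>A. lab p = i \<longrightarrow> pos p \<in> closure (pos ` D))"
proof -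
  obtain S where S: "countable S" "S \<subseteq> pos ` {p \<in> A. lab p = i}" "pos ` {p \<in> A. lab p = i} \<subseteq> closure S"
    by (rule separable)
  define D where "D = (\<lambda>t. pt t i) ` S"
  have "pt t i \<in> A" if "t \<in> S" for t
    using S(2) that assms by (force elim!: pointsE)
  then have "D \<subseteq> {p \<in> A. lab p = i}" by (auto simp: D_def)
  moreover have "pos ` D = S" by (simp add: D_def image_image)
  ultimately show ?thesis using S by (intro exI[of _ D]) (auto simp: D_def)
qed

text \<open>The points labelled \<open>0\<close> form a line with its usual topology. Among the points labelled \<open>2\<close>, only the countably many
  exceptions have to be added to a countable set with dense projection.\<close>

lemma hereditarily_separable_germ_space:
  assumes "Lab = {0, 2}"
  shows "hereditarily_separable germ_space"
  unfolding hereditarily_separable_def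
proof (intro allI impI)
  fix A assume "A \<subseteq> topspace germ_space"
  then have A: "A \<subseteq> points" by simp
  from ex_countable_dense_positions[OF A, of 0] obtain D0 where D0: "countable D0" "D0 \<subseteq> {p \<in> A. lab p = 0}"
    "\<forall>p\<in>A. lab p = 0 \<longrightarrow> pos p \<in> closure (pos ` D0)"
    by (elim exE conjE)
  from ex_countable_dense_positions[OF A, of 2] obtain D2 where D2: "countable D2" "D2 \<subseteq> {p \<in> A. lab p = 2}"
    "\<forall>p\<in>A. lab p = 2 \<longrightarrow> pos p \<in> closure (pos ` D2)"
    by (elim exE conjE)
  have "D2 \<subseteq> points" using D2(2) A by blast
  from countable_exceptions_to_accumulation[OF D2(1) this] obtain B where B: "countable B"
    "\<forall>r W. r \<notin> B \<longrightarrow> r \<in> closure (pos ` D2) \<longrightarrow> openin germ_space W \<longrightarrow>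
      pt r 2 \<in> W \<longrightarrow> (\<exists>p\<in>D2 \<inter> W. p \<noteq> pt r 2)" by (elim exE conjE)
  define D where "D = D0 \<union> D2 \<union> (A \<inter> (\<lambda>t. pt t 2) ` B)"
  have "countable D" unfolding D_def using D0(1) D2(1) B(1) by simp
  have DA: "D \<subseteq> A" unfolding D_def using D0(2) D2(2) by blast
  have "A \<subseteq> germ_space closure_of D"
  proof
    fix p assume p: "p \<in> A"
    then obtain t i where ti: "p = pt t i" "i \<in> Lab" using A by (blast elim: pointsE)
    have "\<exists>y. y \<in> D \<and> y \<in> W" if W: "p \<in> W" "openin germ_space W" for W
    proof -
      consider "i = 0" | "i = 2" using ti(2) assms by blast
      then show ?thesis
      proof cases
        case 1
        have "\<forall>\<^sub>F u in nhds t. pt u 0 \<in> W"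
          using openin_germ_space_nhds[OF W(2), of t 0] W(1) ti 1 by (simp add: germ_0)
        then obtain e where e: "0 < e" "\<forall>u. dist u t < e \<longrightarrow> pt u 0 \<in> W"
          unfolding eventually_nhds_metric by blast
        have "t \<in> closure (pos ` D0)" using D0(3) p ti 1 by force
        then obtain d where d: "d \<in> D0" "dist (pos d) t < e"
          using e(1) unfolding closure_approachable by blast
        then have "d = pt (pos d) 0" using D0(2) A by (fastforce elim!: pointsE)
        then show ?thesis using d e(2) unfolding D_def by (metis UnCI)
      next
        case 2
        show ?thesis
        proof (cases "t \<in> B")
          case True
          then show ?thesis using p ti 2 W(1) by (auto simp: D_def)
        next
          case False
          have "t \<in> closure (pos ` D2)" using D2(3) p ti 2 by force
          then show ?thesis using B(2) False W ti 2 unfolding D_def by blast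
        qed
      qed
    qed
    then show "p \<in> germ_space closure_of D" using p A by (auto simp: in_closure_of)
  qed
  then have "subtopology germ_space A closure_of D = A"
    using DA by (simp add: closure_of_subtopology inf.absorb1 inf.absorb2)
  then show "separable (subtopology germ_space A)"
    unfolding separable_def using \<open>countable D\<close> DA A by (intro exI[of _ D]) (simp add: inf.absorb2)
qed

text \<open>Some label occurs uncountably often in the closed set \<open>E\<close>. A countable \<open>D \<subseteq> E\<close> of that label, dense in
  projection, accumulates at some \<open>(r, 2)\<close>; this point is in \<open>E\<close> as \<open>E\<close> is closed, and is not isolated in \<open>E\<close>.\<close>

lemma no_uncountable_closed_discrete: "\<not> has_uncountable_closed_discrete germ_space"
proof
  assume "has_uncountable_closed_discrete germ_space"
  then obtain E where E: "closedin germ_space E" "uncountable E"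
    and discrete: "subtopology germ_space E = discrete_topology E"
    unfolding has_uncountable_closed_discrete_def by blast
  have EP: "E \<subseteq> points" using closedin_subset[OF E(1)] by simp
  have "E = (\<Union>i. {p \<in> E. lab p = i})" by blast
  then have "\<exists>i. uncountable {p \<in> E. lab p = i}"
    using countable_UN[of "UNIV :: nat set" "\<lambda>i. {p \<in> E. lab p = i}"] E(2) by auto
  then obtain i where i: "uncountable {p \<in> E. lab p = i}" ..
  from ex_countable_dense_positions[OF EP, of i] obtain D where D: "countable D" "D \<subseteq> {p \<in> E. lab p = i}"
    "\<forall>p\<in>E. lab p = i \<longrightarrow> pos p \<in> closure (pos ` D)"
    by (elim exE conjE)
  have "D \<subseteq> points" using D(2) EP by blast
  from countable_exceptions_to_accumulation[OF D(1) this] obtain B where B: "countable B"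
    "\<forall>r W. r \<notin> B \<longrightarrow> r \<in> closure (pos ` D) \<longrightarrow> openin germ_space W \<longrightarrow>
      pt r 2 \<in> W \<longrightarrow> (\<exists>p\<in>D \<inter> W. p \<noteq> pt r 2)" by (elim exE conjE)
  have "\<exists>p\<in>{p \<in> E. lab p = i}. p \<notin> (\<lambda>t. pt t i) ` B"
    by (rule uncountable_imp_not_subset_countable[OF i]) (use B(1) in simp)
  then obtain p where p: "p \<in> E" "lab p = i" "p \<notin> (\<lambda>t. pt t i) ` B" by blast
  define r where "r = pos p"
  have "p = pt r i" using p(1,2) EP by (auto simp: r_def elim!: pointsE)
  then have r: "r \<notin> B" "r \<in> closure (pos ` D)" using p D(3) by (auto simp: r_def)
  have acc: "\<exists>d\<in>D \<inter> W. d \<noteq> pt r 2" if "openin germ_space W" "pt r 2 \<in> W" for W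
    using B(2) r that by blast
  have "pt r 2 \<in> germ_space closure_of E"
    unfolding in_closure_of using acc D(2) Lab(1) by fastforce
  then have "pt r 2 \<in> E" using E(1) by (simp add: closure_of_closedin)
  then have "openin (subtopology germ_space E) {pt r 2}" by (simp add: discrete)
  then obtain W where W: "openin germ_space W" "{pt r 2} = W \<inter> E"
    unfolding openin_subtopology by blast
  have "pt r 2 \<in> W" using W(2) by blast
  from acc[OF W(1) this] obtain d where "d \<in> D" "d \<in> W" "d \<noteq> pt r 2" by blast
  then show False using W(2) D(2) by blast
qed

lemma not_hereditarily_separable_germ_space:
  assumes "1 \<in> Lab"
  shows "\<not> hereditarily_separable germ_space"
proof (rule not_hereditarily_separable_if_uncountable_discrete)
  let ?Y = "range (\<lambda>t. pt t 1)"
  show "?Y \<subseteq> topspace germ_space" using assms by auto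
  have "inj (\<lambda>t. pt t 1)" by (rule injI) simp
  then show "uncountable ?Y"
    using uncountable_UNIV_real by (simp add: countable_image_inj_eq)
  fix y assume "y \<in> ?Y"
  then obtain t where t: "y = pt t 1" by blast
  have "openin germ_space (graph t 1)"
    unfolding graph_def by (rule openin_graph_over[OF assms open_UNIV])
  moreover have "?Y \<inter> graph t 1 = {y}"
    unfolding t graph_def by (auto simp: germ_def split: if_splits)
  ultimately show "\<exists>U. openin germ_space U \<and> ?Y \<inter> U = {y}" by blast
qed

end

lemma ex_accumulating_germ_line:
  fixes pt :: "real \<Rightarrow> nat \<Rightarrow> 'p"
  assumes CH: continuum_hypothesis and Lab: "{0, 2} \<subseteq> Lab" "Lab \<subseteq> {0, 1, 2}"
    and pt: "\<And>t i. pos (pt t i) = t" "\<And>t i. lab (pt t i) = i"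
  shows "\<exists>L T s. accumulating_germ_line pt pos lab Lab L T s"
proof -
  from CH_imp_ex_order[OF CH] obtain L :: "(real \<times> real) set"
    where L: "wf L" "trans L" "total L" "\<forall>r. countable {t. (t, r) \<in> L}" by (elim exE conjE)
  obtain T :: "real \<Rightarrow> nat \<Rightarrow> real \<times> nat" where T: "surj T" using surj_real_to_sequences ..
  interpret section_recursion Lab L T using Lab L T by unfold_locales simp_all
  obtain s where s: "\<forall>r. new_section Lab L T s r (s r)" using ex_sections ..
  have g: "germ s t i t = i" "range (germ s t i) \<subseteq> Lab" "continuous_section s UNIV (germ s t i)"
    "countable {u. germ s t i u \<noteq> 0}" if "i \<in> Lab" for t i
    using germ_of_label[of i s t] s that by auto
  have "accumulating_germ_line pt pos lab Lab L T s"
  proof unfold_locales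
    show "\<exists>i\<in>Lab. i \<noteq> 0" using Lab(1) by (intro bexI[of _ 2]) auto
    show "germ s t i u \<in> Lab" if "i \<in> Lab" for t i u using g(2)[OF that, of t] by blast
    show "\<forall>\<^sub>F v in nhds u. germ s u (germ s t i u) v = germ s t i v" if "i \<in> Lab" for t i u
      using continuous_sectionD[OF g(3)[OF that]] by simp
  qed (use pt Lab(1) g(1,4) s in \<open>auto simp: germ_0\<close>)
  then show ?thesis by blast
qed

text \<open>An injective coding of the labelled reals by sets of reals, with its two decoding functions.\<close>

lemma ex_real_set_coding:
  "\<exists>(pt :: real \<Rightarrow> nat \<Rightarrow> real set) pos lab. (\<forall>t i. pos (pt t i) = t) \<and> (\<forall>t i. lab (pt t i) = i)"
proof -
  define c :: "real \<times> nat \<Rightarrow> real set" where "c p = {fst p, fst p + 1 + real (snd p)}" for p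
  have "inj c"
    by (rule injI) (auto simp: c_def doubleton_eq_iff prod_eq_iff)
  then have "fst (inv c (c (t, i))) = t" "snd (inv c (c (t, i))) = i" for t i by simp_all
  then show ?thesis
    by (intro exI[of _ "\<lambda>t i. c (t, i)"] exI[of _ "\<lambda>x. fst (inv c x)"] exI[of _ "\<lambda>x. snd (inv c x)"]) simp
qed

lemma CH_imp_ENH_manifolds:
  assumes CH: continuum_hypothesis
  shows "\<exists>X :: real set topology. ENH_manifold X \<and> hereditarily_separable X"
    and "\<exists>X :: real set topology. ENH_manifold X \<and> \<not> hereditarily_separable X \<and>
      \<not> has_uncountable_closed_discrete X"
proof -
  from ex_real_set_coding obtain pt :: "real \<Rightarrow> nat \<Rightarrow> real set" and pos lab
    where pt: "\<forall>t i. pos (pt t i) = t" "\<forall>t i. lab (pt t i) = i"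
    by (elim exE conjE)
  show "\<exists>X :: real set topology. ENH_manifold X \<and> hereditarily_separable X"
  proof -
    have "\<exists>L T s. accumulating_germ_line pt pos lab {0, 2} L T s"
      by (rule ex_accumulating_germ_line[OF CH]) (simp_all add: pt)
    then obtain L T s where "accumulating_germ_line pt pos lab {0, 2} L T s" by blast
    then interpret accumulating_germ_line pt pos lab "{0, 2}" L T s .
    show ?thesis using ENH_manifold_germ_space hereditarily_separable_germ_space by blast
  qed
  show "\<exists>X :: real set topology. ENH_manifold X \<and> \<not> hereditarily_separable X \<and>
      \<not> has_uncountable_closed_discrete X"
  proof -
    have "\<exists>L T s. accumulating_germ_line pt pos lab {0, 1, 2} L T s"
      by (rule ex_accumulating_germ_line[OF CH]) (simp_all add: pt)
    then obtain L T s where "accumulating_germ_line pt pos lab {0, 1, 2} L T s" by blast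
    then interpret accumulating_germ_line pt pos lab "{0, 1, 2}" L T s .
    show ?thesis
      using ENH_manifold_germ_space not_hereditarily_separable_germ_space no_uncountable_closed_discrete
      by blast
  qed
qed

section \<open>The three consequences\<close>

theorem theorem5p4:
  shows "(continuum_hypothesis \<longrightarrow>
            (\<exists>X :: real set topology. ENH_manifold X \<and> hereditarily_separable X)) \<and>
         (jensen_diamond \<longrightarrow>
            (\<exists>X :: real set topology. ENH_manifold X \<and> \<not> hereditarily_separable X \<and>
               \<not> has_uncountable_closed_discrete X)) \<and>
         (martins_axiom_omega1 \<longrightarrow>
            \<not> (\<exists>X :: 'a topology. ENH_manifold X \<and> hereditarily_separable X))"
  using CH_imp_ENH_manifolds jensen_diamond_imp_continuum_hypothesis
    MA_ENH_manifold_not_hereditarily_separable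
  by blast

end
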